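(* Let $A$ and $B$ be arrays of $n$ real numbers, each sorted in non-increasing order, and let $k$ be an integer with $1 \le k \le n^2$. Consider the multiset of pairwise sums $A+B = \{A[i]+B[j] : 1 \le i,j \le n\}$ (indexed by pairs $(i,j)$). There is an algorithm (the prune-and-search procedure MAX\_SUM\_CROSS-1 of the paper) that, given random access to $A$ and $B$, finds the $k$ largest elements of $A+B$ (the $k$ pairs $(i,j)$ with the largest values $A[i]+B[j]$, ties broken arbitrarily) in $O(\sqrt{k}\log^{3} k)$ time. The output is represented implicitly, as a staircase submatrix of the matrix $M[i,j]=A[i]+B[j]$, and the $k$ sums can be reported explicitly with an additional $O(k)$ time.
   Context: Computation model: real RAM, where reading an array entry, an addition, or a comparison of reals takes $O(1)$ time. The matrix $M$ with $M[i,j]=A[i]+B[j]$ is never stored; its entries are computed on demand. A staircase submatrix of $M$ is a set of entries described by, for each of a set of consecutive rows and columns, a start index and an end index (contiguous ranges), such that for a row (column) $i+1$ its start index is no larger than that of row (column) $i$ and its end index is no larger than that of row (column) $i$; an implicit representation of the $k$ largest elements means such a description, of size $O(\sqrt{k})$, whose entries are exactly the $k$ selected pairs (up to the specified handling of ties). *)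

theory Defs
  imports Complex_Main
begin

text \<open>Integer memory (indices, counters, output descriptions) and real memory,
both unbounded and addressed by natural numbers; unit-cost instructions.
Real operations available: reading an entry of A or B, addition, subtraction,
comparison, moving reals between cells. The input arrays are read-only and
indexed 1..n.\<close>

datatype instr =
    IConst nat int
  | IAdd nat nat nat
  | ISub nat nat nat
  | IMul nat nat nat
  | IDiv nat nat nat
  | ILoad nat nat
  | IStore nat nat
  | RReadA nat nat
  | RReadB nat nat
  | RAdd nat nat nat
  | RSub nat nat nat
  | RLoad nat nat
  | RStore nat nat
  | JmpILe nat nat nat
  | JmpRLe nat nat nat
  | Jmp nat
  | Halt

record state =
  pc :: nat
  im :: "nat \<Rightarrow> int"
  rm :: "nat \<Rightarrow> real"

fun exec :: "instr \<Rightarrow> (nat \<Rightarrow> real) \<Rightarrow> (nat \<Rightarrow> real) \<Rightarrow> state \<Rightarrow> state" where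
  "exec (IConst r c) A B s = s\<lparr>pc := Suc (pc s), im := (im s)(r := c)\<rparr>"
| "exec (IAdd r a b) A B s = s\<lparr>pc := Suc (pc s), im := (im s)(r := im s a + im s b)\<rparr>"
| "exec (ISub r a b) A B s = s\<lparr>pc := Suc (pc s), im := (im s)(r := im s a - im s b)\<rparr>"
| "exec (IMul r a b) A B s = s\<lparr>pc := Suc (pc s), im := (im s)(r := im s a * im s b)\<rparr>"
| "exec (IDiv r a b) A B s = s\<lparr>pc := Suc (pc s), im := (im s)(r := im s a div im s b)\<rparr>"
| "exec (ILoad r a) A B s = s\<lparr>pc := Suc (pc s), im := (im s)(r := im s (nat (im s a)))\<rparr>"
| "exec (IStore a r) A B s = s\<lparr>pc := Suc (pc s), im := (im s)(nat (im s a) := im s r)\<rparr>"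
| "exec (RReadA r a) A B s = s\<lparr>pc := Suc (pc s), rm := (rm s)(r := A (nat (im s a)))\<rparr>"
| "exec (RReadB r a) A B s = s\<lparr>pc := Suc (pc s), rm := (rm s)(r := B (nat (im s a)))\<rparr>"
| "exec (RAdd r a b) A B s = s\<lparr>pc := Suc (pc s), rm := (rm s)(r := rm s a + rm s b)\<rparr>"
| "exec (RSub r a b) A B s = s\<lparr>pc := Suc (pc s), rm := (rm s)(r := rm s a - rm s b)\<rparr>"
| "exec (RLoad r a) A B s = s\<lparr>pc := Suc (pc s), rm := (rm s)(r := rm s (nat (im s a)))\<rparr>"
| "exec (RStore a r) A B s = s\<lparr>pc := Suc (pc s), rm := (rm s)(nat (im s a) := rm s r)\<rparr>"
| "exec (JmpILe a b l) A B s = s\<lparr>pc := (if im s a \<le> im s b then l else Suc (pc s))\<rparr>"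
| "exec (JmpRLe a b l) A B s = s\<lparr>pc := (if rm s a \<le> rm s b then l else Suc (pc s))\<rparr>"
| "exec (Jmp l) A B s = s\<lparr>pc := l\<rparr>"
| "exec Halt A B s = s"

definition halted :: "instr list \<Rightarrow> state \<Rightarrow> bool" where
  "halted P s \<longleftrightarrow> length P \<le> pc s \<or> P ! pc s = Halt"

definition step :: "instr list \<Rightarrow> (nat \<Rightarrow> real) \<Rightarrow> (nat \<Rightarrow> real) \<Rightarrow> state \<Rightarrow> state" where
  "step P A B s = (if halted P s then s else exec (P ! pc s) A B s)"

text \<open>\<open>runs P A B s t s'\<close>: started in \<open>s\<close>, program \<open>P\<close> has halted after exactly
\<open>t\<close> steps, in state \<open>s'\<close> (so its running time is at most \<open>t\<close>).\<close>
definition runs :: "instr list \<Rightarrow> (nat \<Rightarrow> real) \<Rightarrow> (nat \<Rightarrow> real) \<Rightarrow> state \<Rightarrow> nat \<Rightarrow> state \<Rightarrow> bool" where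
  "runs P A B s t s' \<longleftrightarrow> s' = (step P A B ^^ t) s \<and> halted P s'"

definition init :: "nat \<Rightarrow> nat \<Rightarrow> state" where
  "init n k = \<lparr>pc = 0, im = (\<lambda>i. if i = 0 then int n else if i = 1 then int k else 0),
               rm = (\<lambda>_. 0)\<rparr>"

definition grid :: "nat \<Rightarrow> (int \<times> int) set" where
  "grid n = {1..int n} \<times> {1..int n}"

definition Mval :: "(nat \<Rightarrow> real) \<Rightarrow> (nat \<Rightarrow> real) \<Rightarrow> int \<times> int \<Rightarrow> real" where
  "Mval A B p = A (nat (fst p)) + B (nat (snd p))"

definition top_k :: "(nat \<Rightarrow> real) \<Rightarrow> (nat \<Rightarrow> real) \<Rightarrow> nat \<Rightarrow> nat \<Rightarrow> (int \<times> int) set \<Rightarrow> bool" where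
  "top_k A B n k S \<longleftrightarrow> S \<subseteq> grid n \<and> card S = k \<and>
     (\<forall>p\<in>S. \<forall>q\<in>grid n - S. Mval A B q \<le> Mval A B p)"

definition row_slice :: "(int \<times> int) set \<Rightarrow> int \<Rightarrow> int set" where
  "row_slice S i = {j. (i, j) \<in> S}"

definition is_staircase :: "(int \<times> int) set \<Rightarrow> bool" where
  "is_staircase S \<longleftrightarrow> finite S \<and>
     (\<forall>i j1 j2 j. (i, j1) \<in> S \<longrightarrow> (i, j2) \<in> S \<longrightarrow> j1 \<le> j \<longrightarrow> j \<le> j2 \<longrightarrow> (i, j) \<in> S) \<and>
     (\<forall>i1 i2 i. row_slice S i1 \<noteq> {} \<longrightarrow> row_slice S i2 \<noteq> {} \<longrightarrow> i1 \<le> i \<longrightarrow> i \<le> i2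
                 \<longrightarrow> row_slice S i \<noteq> {}) \<and>
     (\<forall>i. row_slice S i \<noteq> {} \<longrightarrow> row_slice S (i + 1) \<noteq> {} \<longrightarrow>
          Min (row_slice S (i + 1)) \<le> Min (row_slice S i) \<and>
          Max (row_slice S (i + 1)) \<le> Max (row_slice S i))"

definition num_desc :: "state \<Rightarrow> nat" where
  "num_desc s = nat (im s 0)"

definition decode :: "state \<Rightarrow> (int \<times> int) set" where
  "decode s = (\<Union>t\<in>{..<num_desc s}.
      (let kd = im s (4*t+1); a = im s (4*t+2); lo = im s (4*t+3); hi = im s (4*t+4) in
       if kd = 0 then {(a, j) | j. lo \<le> j \<and> j \<le> hi} else {(i, a) | i. lo \<le> i \<and> i \<le> hi}))"

definition lists_explicitly :: "(nat \<Rightarrow> real) \<Rightarrow> (nat \<Rightarrow> real) \<Rightarrow> nat \<Rightarrow> (int \<times> int) set \<Rightarrow> state \<Rightarrow> bool" where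
  "lists_explicitly A B k S s \<longleftrightarrow>
     inj_on (\<lambda>t. (im s (2*t+1), im s (2*t+2))) {..<k} \<and>
     (\<lambda>t. (im s (2*t+1), im s (2*t+2))) ` {..<k} = S \<and>
     (\<forall>t<k. rm s t = Mval A B (im s (2*t+1), im s (2*t+2)))"

definition sorted_noninc :: "(nat \<Rightarrow> real) \<Rightarrow> nat \<Rightarrow> bool" where
  "sorted_noninc A n \<longleftrightarrow> (\<forall>i j. 1 \<le> i \<longrightarrow> i \<le> j \<longrightarrow> j \<le> n \<longrightarrow> A j \<le> A i)"

end

theory Submission
  imports Defs
begin

text \<open>If \<open>r\<close> is the least number with \<open>k \<le> r * r\<close>, the \<open>k\<close> largest sums can be chosen in the first \<open>r\<close> rows
  and columns, because every other entry is dominated by the \<open>r * r\<close> entries of the leading square. So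
  it suffices to select from \<open>m = 2 * r\<close> sorted lists. Keep a prefix of each list as accepted. With step
  width \<open>s\<close> and more than \<open>m * (s - 1)\<close> entries still to be accepted, look \<open>s\<close> positions ahead in every list
  and accept the next \<open>s\<close> entries of the list where the largest entry is found: fewer than \<open>k\<close> entries can
  precede that entry. When this is no longer possible, halve \<open>s\<close>, starting from \<open>k\<close>; after the phase with
  \<open>s = 1\<close> nothing remains. A phase accepts at most \<open>2 * m\<close> times, and a tournament tree finds the
  winning list in logarithmic time, so the selection takes \<open>O (sqrt k * (log k)\<^sup>2)\<close> steps. With ties
  broken by the list index the accepted set is a Young diagram, hence a staircase.\<close>

section \<open>Structured programs\<close>

text \<open>A phase of width \<open>s\<close> inherits at most \<open>m * (s' - 1)\<close> open
  entries from the previous width \<open>s'\<close>, where \<open>s = s' div 2\<close>. Since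
  \<open>s' - 1 \<le> 2 * s\<close>, these are at most \<open>2 * m * s\<close>, hence the
  \<open>2 * m\<close> acceptances; for the first phase the width \<open>k\<close> makes this bound
  trivial. During the run the accepted set need not be an initial segment of the order: only ranks
  below \<open>k\<close> are maintained, and a count at the end gives the rest. Time is counted in
  machine instructions, so before the reporting no work proportional to \<open>n\<close> or
  \<open>k\<close> is affordable. The lists are never copied; only their ends are stored, four cells
  per list, in the very format that \<open>decode\<close> reads. The registers occupy the cells of
  the first eight descriptors, therefore the lists begin at cell 33 and those eight are made empty
  at the end. The clock is part of the postcondition, so correctness, termination and time come from
  one invariant per loop.\<close>

datatype cond = LeI nat nat | LeR nat nat

datatype com =
    Blk "instr list"
  | Seq com com (infixr \<open>;;\<close> 60)
  | Choose cond com com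
  | Loop cond com

fun straight :: "instr \<Rightarrow> bool" where
  "straight (JmpILe _ _ _) = False"
| "straight (JmpRLe _ _ _) = False"
| "straight (Jmp _) = False"
| "straight Halt = False"
| "straight _ = True"

fun holds :: "cond \<Rightarrow> (nat \<Rightarrow> int) \<Rightarrow> (nat \<Rightarrow> real) \<Rightarrow> bool" where
  "holds (LeI a b) i r = (i a \<le> i b)"
| "holds (LeR a b) i r = (r a \<le> r b)"

fun jump :: "cond \<Rightarrow> nat \<Rightarrow> instr" where
  "jump (LeI a b) l = JmpILe a b l"
| "jump (LeR a b) l = JmpRLe a b l"

text \<open>The machine has no negated conditional jump. \<open>Choose\<close> therefore puts its
  second branch right behind the test and jumps from its end over the first branch;
  \<open>Loop\<close> needs a test, an exit jump and a jump back.\<close>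

fun clen :: "com \<Rightarrow> nat" where
  "clen (Blk xs) = length xs"
| "clen (c ;; d) = clen c + clen d"
| "clen (Choose b c d) = clen c + clen d + 2"
| "clen (Loop b c) = clen c + 3"

text \<open>The first argument is the address of the code; jump targets are absolute.\<close>

fun compile :: "nat \<Rightarrow> com \<Rightarrow> instr list" where
  "compile p (Blk xs) = xs"
| "compile p (c ;; d) = compile p c @ compile (p + clen c) d"
| "compile p (Choose b c d) =
     jump b (p + clen d + 2) # compile (p + 1) d @ Jmp (p + clen c + clen d + 2) # compile (p + clen d + 2) c"
| "compile p (Loop b c) = jump b (p + 2) # Jmp (p + clen c + 3) # compile (p + 2) c @ [Jmp p]"

lemma length_compile [simp]: "length (compile p c) = clen c"
  by (induction c arbitrary: p) auto

definition code_at :: "instr list \<Rightarrow> nat \<Rightarrow> instr list \<Rightarrow> bool" where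
  "code_at P p xs \<longleftrightarrow> (\<exists>ys zs. P = ys @ xs @ zs \<and> length ys = p)"

lemma code_at_append: "code_at P p (xs @ ys) \<Longrightarrow> code_at P p xs \<and> code_at P (p + length xs) ys"
  unfolding code_at_def by (metis append.assoc length_append)

lemma code_at_Cons: "code_at P p (x # xs) \<Longrightarrow> p < length P \<and> P ! p = x \<and> code_at P (Suc p) xs"
proof -
  assume "code_at P p (x # xs)"
  then obtain ys zs where "P = ys @ (x # xs) @ zs" "length ys = p"
    unfolding code_at_def by blast
  then show ?thesis
    unfolding code_at_def by (intro conjI exI[of _ "ys @ [x]"] exI[of _ zs]) auto
qed

definition reach :: "instr list \<Rightarrow> (nat \<Rightarrow> real) \<Rightarrow> (nat \<Rightarrow> real) \<Rightarrow> nat \<Rightarrow> (nat \<Rightarrow> int) \<Rightarrow> (nat \<Rightarrow> real)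
    \<Rightarrow> nat \<Rightarrow> nat \<Rightarrow> (nat \<Rightarrow> int) \<Rightarrow> (nat \<Rightarrow> real) \<Rightarrow> bool" where
  "reach P A B p i r t p' i' r' \<longleftrightarrow>
     (step P A B ^^ t) \<lparr>pc = p, im = i, rm = r\<rparr> = \<lparr>pc = p', im = i', rm = r'\<rparr>"

lemma reach_0 [simp]: "reach P A B p i r 0 p i r"
  by (simp add: reach_def)

lemma reach_trans:
  "reach P A B p i r t p' i' r' \<Longrightarrow> reach P A B p' i' r' u p'' i'' r'' \<Longrightarrow>
   reach P A B p i r (t + u) p'' i'' r''"
  unfolding reach_def by (subst add.commute) (simp add: funpow_add)

lemma reach_Suc:
  "step P A B \<lparr>pc = p, im = i, rm = r\<rparr> = \<lparr>pc = p', im = i', rm = r'\<rparr> \<Longrightarrow>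
   reach P A B p' i' r' t p'' i'' r'' \<Longrightarrow> reach P A B p i r (Suc t) p'' i'' r''"
  unfolding reach_def by (simp add: funpow_Suc_right del: funpow.simps)

lemma step_jump:
  assumes "p < length P" "P ! p = jump b l"
  shows "step P A B \<lparr>pc = p, im = i, rm = r\<rparr> =
    \<lparr>pc = (if holds b i r then l else Suc p), im = i, rm = r\<rparr>"
  using assms by (cases b) (auto simp: step_def halted_def)

lemma step_Jmp:
  assumes "p < length P" "P ! p = Jmp l"
  shows "step P A B \<lparr>pc = p, im = i, rm = r\<rparr> = \<lparr>pc = l, im = i, rm = r\<rparr>"
  using assms by (auto simp: step_def halted_def)

text \<open>The effect on the memories does not depend on the program counter. Evaluating at
  \<open>pc = 0\<close> frees symbolic execution from addresses.\<close>

lemma step_straight: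
  assumes "p < length P" "P ! p = x" "straight x"
  shows "step P A B \<lparr>pc = p, im = i, rm = r\<rparr> =
    \<lparr>pc = Suc p, im = im (exec x A B \<lparr>pc = 0, im = i, rm = r\<rparr>),
     rm = rm (exec x A B \<lparr>pc = 0, im = i, rm = r\<rparr>)\<rparr>"
  using assms by (cases x) (auto simp: step_def halted_def)

text \<open>Weakest preconditions with a clock: the postcondition also sees the time \<open>\<tau>\<close> elapsed so far.\<close>

definition wp :: "(nat \<Rightarrow> real) \<Rightarrow> (nat \<Rightarrow> real) \<Rightarrow> com \<Rightarrow> (nat \<Rightarrow> (nat \<Rightarrow> int) \<Rightarrow> (nat \<Rightarrow> real) \<Rightarrow> bool)
    \<Rightarrow> nat \<Rightarrow> (nat \<Rightarrow> int) \<Rightarrow> (nat \<Rightarrow> real) \<Rightarrow> bool" where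
  "wp A B c Q \<tau> i r \<longleftrightarrow> (\<exists>t i' r'. Q (\<tau> + t) i' r' \<and>
     (\<forall>P p. code_at P p (compile p c) \<longrightarrow> reach P A B p i r t (p + clen c) i' r'))"

text \<open>\<open>wp\<close> fixes the time and the final memories before program and address are
  chosen, so the two runs concatenate wherever the code is placed.\<close>

lemma wp_Seq:
  assumes "wp A B c (\<lambda>\<tau> i r. wp A B d Q \<tau> i r) \<tau> i r"
  shows "wp A B (c ;; d) Q \<tau> i r"
proof -
  obtain t i1 r1 u i2 r2 where *: "Q (\<tau> + t + u) i2 r2"
     "\<And>P p. code_at P p (compile p c) \<Longrightarrow> reach P A B p i r t (p + clen c) i1 r1"
     "\<And>P p. code_at P p (compile p d) \<Longrightarrow> reach P A B p i1 r1 u (p + clen d) i2 r2"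
    using assms unfolding wp_def by blast
  have "reach P A B p i r (t + u) (p + clen (c ;; d)) i2 r2"
    if "code_at P p (compile p (c ;; d))" for P p
  proof -
    from that have "code_at P p (compile p c)" "code_at P (p + clen c) (compile (p + clen c) d)"
      using code_at_append by fastforce+
    then show ?thesis using reach_trans[OF *(2) *(3)] by (simp add: add.assoc)
  qed
  with *(1) show ?thesis unfolding wp_def by (metis add.assoc)
qed

lemma code_at_Choose:
  assumes "code_at P p (compile p (Choose b c d))"
  shows "p < length P" "P ! p = jump b (p + clen d + 2)" "code_at P (Suc p) (compile (Suc p) d)"
    "Suc p + clen d < length P" "P ! (Suc p + clen d) = Jmp (p + clen c + clen d + 2)"
    "code_at P (p + clen d + 2) (compile (p + clen d + 2) c)"
proof -
  from code_at_Cons[OF assms[unfolded compile.simps]]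
  have 1: "p < length P" "P ! p = jump b (p + clen d + 2)"
    "code_at P (Suc p) (compile (p + 1) d @ Jmp (p + clen c + clen d + 2) # compile (p + clen d + 2) c)"
    by auto
  from code_at_append[OF 1(3)] have 2: "code_at P (Suc p) (compile (p + 1) d)"
    "code_at P (Suc p + clen d) (Jmp (p + clen c + clen d + 2) # compile (p + clen d + 2) c)"
    by simp_all
  from 1(1,2) 2(1) code_at_Cons[OF 2(2)] show
    "p < length P" "P ! p = jump b (p + clen d + 2)" "code_at P (Suc p) (compile (Suc p) d)"
    "Suc p + clen d < length P" "P ! (Suc p + clen d) = Jmp (p + clen c + clen d + 2)"
    "code_at P (p + clen d + 2) (compile (p + clen d + 2) c)"
    by simp_all
qed

lemma code_at_Loop:
  assumes "code_at P p (compile p (Loop b c))"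
  shows "p < length P" "P ! p = jump b (p + 2)" "Suc p < length P" "P ! Suc p = Jmp (p + clen c + 3)"
    "code_at P (p + 2) (compile (p + 2) c)"
    "p + 2 + clen c < length P" "P ! (p + 2 + clen c) = Jmp p"
proof -
  from code_at_Cons[OF assms[unfolded compile.simps]]
  have 1: "p < length P" "P ! p = jump b (p + 2)"
    "code_at P (Suc p) (Jmp (p + clen c + 3) # compile (p + 2) c @ [Jmp p])"
    by auto
  from code_at_Cons[OF 1(3)] have 2: "Suc p < length P" "P ! Suc p = Jmp (p + clen c + 3)"
    "code_at P (p + 2) (compile (p + 2) c @ [Jmp p])"
    by simp_all
  from code_at_append[OF 2(3)] have 3: "code_at P (p + 2) (compile (p + 2) c)"
    "code_at P (p + 2 + clen c) [Jmp p]"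
    by simp_all
  from 1(1,2) 2(1,2) 3(1) code_at_Cons[OF 3(2)] show
    "p < length P" "P ! p = jump b (p + 2)" "Suc p < length P" "P ! Suc p = Jmp (p + clen c + 3)"
    "code_at P (p + 2) (compile (p + 2) c)"
    "p + 2 + clen c < length P" "P ! (p + 2 + clen c) = Jmp p"
    by simp_all
qed

text \<open>Only the second branch ends with a jump, hence the extra time unit in its
  postcondition.\<close>

lemma wp_Choose:
  assumes "holds b i r \<Longrightarrow> wp A B c (\<lambda>\<tau> i r. Q \<tau> i r) (\<tau> + 1) i r"
    and "\<not> holds b i r \<Longrightarrow> wp A B d (\<lambda>\<tau> i r. Q (\<tau> + 1) i r) (\<tau> + 1) i r"
  shows "wp A B (Choose b c d) Q \<tau> i r"
proof (cases "holds b i r")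
  case True
  obtain t i' r' where *: "Q (\<tau> + 1 + t) i' r'"
     "\<And>P p. code_at P p (compile p c) \<Longrightarrow> reach P A B p i r t (p + clen c) i' r'"
    using assms(1)[OF True] unfolding wp_def by blast
  have "reach P A B p i r (Suc t) (p + clen (Choose b c d)) i' r'"
    if "code_at P p (compile p (Choose b c d))" for P p
  proof -
    have a: "p < length P" "P ! p = jump b (p + clen d + 2)" "code_at P (p + clen d + 2) (compile (p + clen d + 2) c)"
      using code_at_Choose[OF that] by blast+
    show ?thesis
      by (rule reach_Suc[OF step_jump[OF a(1,2)]]) (use True *(2)[OF a(3)] in \<open>simp add: ac_simps\<close>)
  qed
  with *(1) show ?thesis unfolding wp_def by (metis add.assoc plus_1_eq_Suc)
next
  case False
  obtain t i' r' where *: "Q (\<tau> + 1 + t + 1) i' r'"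
     "\<And>P p. code_at P p (compile p d) \<Longrightarrow> reach P A B p i r t (p + clen d) i' r'"
    using assms(2)[OF False] unfolding wp_def by blast
  have "reach P A B p i r (Suc (t + Suc 0)) (p + clen (Choose b c d)) i' r'"
    if "code_at P p (compile p (Choose b c d))" for P p
  proof -
    have a: "p < length P" "P ! p = jump b (p + clen d + 2)" "code_at P (Suc p) (compile (Suc p) d)"
       "Suc p + clen d < length P" "P ! (Suc p + clen d) = Jmp (p + clen c + clen d + 2)"
      using code_at_Choose[OF that] by blast+
    have "reach P A B (Suc p + clen d) i' r' (Suc 0) (p + clen (Choose b c d)) i' r'"
      by (rule reach_Suc[OF step_Jmp[OF a(4,5)]]) (simp add: ac_simps)
    then show ?thesis
      by (intro reach_Suc[OF step_jump[OF a(1,2)]], simp only: False if_False)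
        (rule reach_trans[OF *(2)[OF a(3)]])
  qed
  moreover have "Q (\<tau> + Suc (t + Suc 0)) i' r'" using *(1) by (simp add: ac_simps)
  ultimately show ?thesis unfolding wp_def by blast
qed

text \<open>Time strictly increases, so an invariant that bounds the clock also proves termination.\<close>

lemma wp_Loop:
  assumes "Inv \<tau> i r"
    and bnd: "\<And>\<tau> i r. Inv \<tau> i r \<Longrightarrow> \<tau> \<le> T"
    and body: "\<And>\<tau> i r. Inv \<tau> i r \<Longrightarrow> holds b i r \<Longrightarrow> wp A B c (\<lambda>\<tau> i r. Inv (\<tau> + 1) i r) (\<tau> + 1) i r"
    and ex: "\<And>\<tau> i r. Inv \<tau> i r \<Longrightarrow> \<not> holds b i r \<Longrightarrow> Q (\<tau> + 2) i r"
  shows "wp A B (Loop b c) Q \<tau> i r"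
  using assms(1)
proof (induction "T - \<tau>" arbitrary: \<tau> i r rule: less_induct)
  case less
  show ?case
  proof (cases "holds b i r")
    case True
    obtain t i1 r1 where *: "Inv (\<tau> + 1 + t + 1) i1 r1"
       "\<And>P p. code_at P p (compile p c) \<Longrightarrow> reach P A B p i r t (p + clen c) i1 r1"
      using body[OF less.prems True] unfolding wp_def by blast
    \<comment> \<open>The bound holds at the new state as well, so the truncated subtraction really
      decreases.\<close>
    have "T - (\<tau> + 1 + t + 1) < T - \<tau>"
      using bnd[OF *(1)] by simp
    from less.hyps[OF this *(1)] obtain u i2 r2 where **: "Q (\<tau> + 1 + t + 1 + u) i2 r2"
       "\<And>P p. code_at P p (compile p (Loop b c)) \<Longrightarrow> reach P A B p i1 r1 u (p + clen (Loop b c)) i2 r2"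
      unfolding wp_def by blast
    have "reach P A B p i r (Suc (t + Suc u)) (p + clen (Loop b c)) i2 r2"
      if L: "code_at P p (compile p (Loop b c))" for P p
    proof -
      have a: "p < length P" "P ! p = jump b (p + 2)" "code_at P (p + 2) (compile (p + 2) c)"
         "p + 2 + clen c < length P" "P ! (p + 2 + clen c) = Jmp p"
        using code_at_Loop[OF L] by blast+
      show ?thesis
        by (rule reach_Suc[OF step_jump[OF a(1,2)]], simp only: True if_True)
          (rule reach_trans[OF *(2)[OF a(3)] reach_Suc[OF step_Jmp[OF a(4,5)] **(2)[OF L]]])
    qed
    moreover have "Q (\<tau> + Suc (t + Suc u)) i2 r2" using **(1) by (simp add: ac_simps)
    ultimately show ?thesis unfolding wp_def by blast
  next
    case False
    have "reach P A B p i r (Suc (Suc 0)) (p + clen (Loop b c)) i r"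
      if L: "code_at P p (compile p (Loop b c))" for P p
    proof -
      have a: "p < length P" "P ! p = jump b (p + 2)" "Suc p < length P" "P ! Suc p = Jmp (p + clen c + 3)"
        using code_at_Loop[OF L] by blast+
      show ?thesis
        by (rule reach_Suc[OF step_jump[OF a(1,2)]], simp only: False if_False)
          (rule reach_Suc[OF step_Jmp[OF a(3,4)]], simp add: ac_simps)
    qed
    then show ?thesis using ex[OF less.prems False] unfolding wp_def numeral_2_eq_2 by blast
  qed
qed

text \<open>Symbolic execution by recursion, so that the simplifier computes clock and memories at
  the end of a concrete block.\<close>

primrec eff :: "(nat \<Rightarrow> real) \<Rightarrow> (nat \<Rightarrow> real) \<Rightarrow> instr list \<Rightarrow> (nat \<Rightarrow> (nat \<Rightarrow> int) \<Rightarrow> (nat \<Rightarrow> real) \<Rightarrow> bool)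
    \<Rightarrow> nat \<Rightarrow> (nat \<Rightarrow> int) \<Rightarrow> (nat \<Rightarrow> real) \<Rightarrow> bool" where
  "eff A B [] Q \<tau> i r = Q \<tau> i r"
| "eff A B (x # xs) Q \<tau> i r = eff A B xs Q (\<tau> + 1)
     (im (exec x A B \<lparr>pc = 0, im = i, rm = r\<rparr>)) (rm (exec x A B \<lparr>pc = 0, im = i, rm = r\<rparr>))"

lemma wp_Blk:
  assumes "list_all straight xs" "eff A B xs Q \<tau> i r"
  shows "wp A B (Blk xs) Q \<tau> i r"
  using assms
proof (induction xs arbitrary: \<tau> i r)
  case Nil
  then show ?case unfolding wp_def by (intro exI[of _ 0] exI[of _ i] exI[of _ r]) simp
next
  case (Cons x xs)
  let ?s = "exec x A B \<lparr>pc = 0, im = i, rm = r\<rparr>"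
  have "wp A B (Blk xs) Q (\<tau> + 1) (im ?s) (rm ?s)"
    using Cons by simp
  then obtain t i' r' where *: "Q (\<tau> + 1 + t) i' r'"
     "\<And>P p. code_at P p xs \<Longrightarrow> reach P A B p (im ?s) (rm ?s) t (p + length xs) i' r'"
    unfolding wp_def by auto
  have "reach P A B p i r (Suc t) (p + clen (Blk (x # xs))) i' r'"
    if "code_at P p (compile p (Blk (x # xs)))" for P p
  proof -
    have a: "p < length P" "P ! p = x" "code_at P (Suc p) xs"
      using that code_at_Cons[of P p] by auto
    show ?thesis
      by (rule reach_Suc[OF step_straight[OF a(1,2)]]) (use Cons.prems *(2)[OF a(3)] in simp_all)
  qed
  then show ?case using *(1) unfolding wp_def by (metis add.assoc plus_1_eq_Suc)
qed

text \<open>For code alone at address 0 the final program counter is the program length, which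
  counts as halted.\<close>

lemma wp_runs:
  assumes "wp A B c Q 0 (im s) (rm s)" "pc s = 0"
  shows "\<exists>t s'. runs (compile 0 c) A B s t s' \<and> Q t (im s') (rm s')"
proof -
  obtain t i' r' where Q: "Q (0 + t) i' r'"
     and R: "\<forall>P p. code_at P p (compile p c) \<longrightarrow> reach P A B p (im s) (rm s) t (p + clen c) i' r'"
    using assms(1) unfolding wp_def by blast
  have "code_at (compile 0 c) 0 (compile 0 c)"
    unfolding code_at_def by (rule exI[of _ "[]"]) simp
  with R have "reach (compile 0 c) A B 0 (im s) (rm s) t (0 + clen c) i' r'"
    by blast
  moreover have "s = \<lparr>pc = 0, im = im s, rm = rm s\<rparr>"
    using assms(2) by (cases s) simp
  ultimately have "(step (compile 0 c) A B ^^ t) s = \<lparr>pc = clen c, im = i', rm = r'\<rparr>"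
    unfolding reach_def by (metis add_0)
  then have "runs (compile 0 c) A B s t \<lparr>pc = clen c, im = i', rm = r'\<rparr>"
    by (simp add: runs_def halted_def)
  with Q show ?thesis by (intro exI[of _ t] exI[of _ "\<lparr>pc = clen c, im = i', rm = r'\<rparr>"]) simp
qed

section \<open>Selection from sorted lists\<close>

text \<open>All lists share the last position \<open>n\<close>. The value
  \<open>lo w = n + 1\<close> stands for an empty list, as happens for the column parts when
  \<open>r = n\<close>.\<close>

locale sorted_lists =
  fixes m :: nat and n :: int and lo :: "nat \<Rightarrow> int" and val :: "nat \<Rightarrow> int \<Rightarrow> real" and k :: nat
  assumes val_mono: "w < m \<Longrightarrow> lo w \<le> p \<Longrightarrow> p \<le> q \<Longrightarrow> q \<le> n \<Longrightarrow> val w q \<le> val w p"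
    and lo_le: "w < m \<Longrightarrow> lo w \<le> n + 1"
begin

definition entries :: "(nat \<times> int) set" where
  "entries = (SIGMA w:{..<m}. {lo w..n})"

definition bef :: "nat \<times> int \<Rightarrow> nat \<times> int \<Rightarrow> bool" where
  "bef x y \<longleftrightarrow> val (fst y) (snd y) < val (fst x) (snd x) \<or>
     val (fst y) (snd y) = val (fst x) (snd x) \<and> (fst x < fst y \<or> fst x = fst y \<and> snd x < snd y)"

definition rank :: "nat \<times> int \<Rightarrow> nat" where
  "rank x = card {y \<in> entries. bef y x}"

definition accepted :: "(nat \<Rightarrow> int) \<Rightarrow> (nat \<times> int) set" where
  "accepted hi = (SIGMA w:{..<m}. {lo w..hi w})"

text \<open>Deliberately weaker than closure under \<open>bef\<close>: a list that is ahead may skip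
  entries of other lists which are accepted later.\<close>

definition good :: "(nat \<Rightarrow> int) \<Rightarrow> bool" where
  "good hi \<longleftrightarrow> (\<forall>w<m. lo w - 1 \<le> hi w \<and> hi w \<le> n) \<and> (\<forall>x\<in>accepted hi. rank x < k)"

definition taken :: "(nat \<Rightarrow> int) \<Rightarrow> int" where
  "taken hi = (\<Sum>w<m. hi w - lo w + 1)"

lemma bef_trans: "bef x y \<Longrightarrow> bef y z \<Longrightarrow> bef x z"
  unfolding bef_def by auto

lemma bef_irrefl: "\<not> bef x x"
  unfolding bef_def by auto

lemma bef_total: "x \<noteq> y \<Longrightarrow> bef x y \<or> bef y x"
  unfolding bef_def by (cases x; cases y) auto

lemma bef_same_list: "w < m \<Longrightarrow> lo w \<le> p \<Longrightarrow> p < q \<Longrightarrow> q \<le> n \<Longrightarrow> bef (w, p) (w, q)"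
  using val_mono[of w p q] unfolding bef_def by auto

lemma finite_entries [simp]: "finite entries"
  unfolding entries_def by auto

lemma finite_accepted [simp]: "finite (accepted hi)"
  unfolding accepted_def by auto

lemma accepted_subset: "good hi \<Longrightarrow> accepted hi \<subseteq> entries"
  unfolding accepted_def entries_def good_def by fastforce

text \<open>Kept free of \<open>good\<close>, because it is also applied to the full lists, whose
  entries may have rank \<open>k\<close> or more.\<close>

lemma card_prefixes:
  assumes "\<And>w. w < m \<Longrightarrow> lo w - 1 \<le> hi w"
  shows "int (card (accepted hi)) = taken hi"
proof -
  have "card (accepted hi) = (\<Sum>w<m. card {lo w..hi w})"
    unfolding accepted_def by (rule card_SigmaI) auto
  then have "int (card (accepted hi)) = (\<Sum>w<m. int (card {lo w..hi w}))"
    by simp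
  also have "\<dots> = taken hi"
    unfolding taken_def by (rule sum.cong) (use assms in \<open>fastforce+\<close>)
  finally show ?thesis .
qed

lemma card_accepted: "good hi \<Longrightarrow> int (card (accepted hi)) = taken hi"
  by (rule card_prefixes) (auto simp: good_def)

lemma rank_mono: "bef x y \<Longrightarrow> rank x \<le> rank y"
  unfolding rank_def by (rule card_mono) (auto intro: bef_trans)

lemma rank_strict: "bef x y \<Longrightarrow> x \<in> entries \<Longrightarrow> rank x < rank y"
  unfolding rank_def using bef_irrefl bef_trans by (intro psubset_card_mono) (simp, blast)

text \<open>Every list has at most \<open>s - 1\<close> unaccepted entries before the one that is \<open>s\<close> ahead in the winning
  list, so that entry is among the \<open>k\<close> first ones.\<close>

lemma good_accept:
  assumes g: "good hi" and s: "1 \<le> s" and room: "int m * (s - 1) < int k - taken hi"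
    and w: "w < m" "hi w + s \<le> n"
    and best: "\<And>w'. w' < m \<Longrightarrow> w' \<noteq> w \<Longrightarrow> hi w' + s \<le> n \<Longrightarrow> bef (w, hi w + s) (w', hi w' + s)"
  shows "good (hi(w := hi w + s))"
proof -
  let ?x = "(w, hi w + s)"
  let ?N = "SIGMA w':{..<m}. {hi w' + 1..hi w' + s - 1}"
  have lohi: "lo w' - 1 \<le> hi w'" if "w' < m" for w'
    using g that unfolding good_def by auto
  have sub: "{y \<in> entries. bef y ?x} \<subseteq> accepted hi \<union> ?N"
  proof
    fix y assume y: "y \<in> {y \<in> entries. bef y ?x}"
    obtain w' p where yp: "y = (w', p)" by (cases y)
    have e: "w' < m" "lo w' \<le> p" "p \<le> n" "bef y ?x"
      using y yp unfolding entries_def by auto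
    \<comment> \<open>Otherwise list \<open>w'\<close> has an entry \<open>s\<close> ahead; it does
      not precede \<open>?x\<close> by \<open>best\<close>, and \<open>y\<close> does not precede it
      within the list.\<close>
    have "p < hi w' + s"
    proof (rule ccontr)
      assume a: "\<not> p < hi w' + s"
      then have h: "hi w' + s \<le> n" using e by simp
      have "?x = (w', hi w' + s) \<or> bef ?x (w', hi w' + s)"
        using best[OF e(1) _ h] by auto
      moreover have "(w', hi w' + s) = y \<or> bef (w', hi w' + s) y"
        using bef_same_list[OF e(1), of "hi w' + s" p] a e lohi[OF e(1)] s yp by force
      ultimately have "?x = y \<or> bef ?x y"
        using bef_trans by metis
      then show False using e(4) bef_trans bef_irrefl by metis
    qed
    then show "y \<in> accepted hi \<union> ?N"
      using e yp unfolding accepted_def by auto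
  qed
  have "card ?N = (\<Sum>w'<m. card {hi w' + 1..hi w' + s - 1})"
    by (rule card_SigmaI) auto
  also have "\<dots> = m * nat (s - 1)" by simp
  finally have N: "int (card ?N) = int m * (s - 1)" using s by simp
  have "rank ?x \<le> card (accepted hi \<union> ?N)"
    unfolding rank_def by (rule card_mono[OF _ sub]) auto
  also have "\<dots> \<le> card (accepted hi) + card ?N" by (rule card_Un_le)
  finally have "int (rank ?x) < int k"
    using N room card_accepted[OF g] by linarith
  then have rx: "rank ?x < k" by simp
  have "rank z < k" if z: "z \<in> accepted (hi(w := hi w + s))" for z
  proof (cases "z \<in> accepted hi")
    case True
    then show ?thesis using g unfolding good_def by auto
  next
    case False
    then obtain p where p: "z = (w, p)" "hi w < p" "p \<le> hi w + s" "lo w \<le> p"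
      using z unfolding accepted_def by (cases z) (auto split: if_splits)
    show ?thesis
    proof (cases "p = hi w + s")
      case True
      then show ?thesis using p rx by simp
    next
      case False
      \<comment> \<open>Entries accepted together with \<open>?x\<close> precede it in their own
        list, so the rank of \<open>?x\<close> bounds theirs.\<close>
      then have "bef z ?x" using bef_same_list[of w p "hi w + s"] p w by auto
      from rank_mono[OF this] rx show ?thesis by simp
    qed
  qed
  moreover have "lo w' - 1 \<le> (hi(w := hi w + s)) w' \<and> (hi(w := hi w + s)) w' \<le> n" if "w' < m" for w'
    using g w s that lohi[OF that] unfolding good_def by auto
  ultimately show ?thesis unfolding good_def by blast
qed

text \<open>If every list had fewer than \<open>s\<close> entries left, there would be at most
  \<open>taken hi + m * (s - 1) < k\<close> entries in all.\<close>

lemma exists_long_list: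
  assumes g: "good hi" and room: "int m * (s - 1) < int k - taken hi" and k: "k \<le> card entries"
  shows "\<exists>w<m. hi w + s \<le> n"
proof (rule ccontr)
  assume c: "\<not> (\<exists>w<m. hi w + s \<le> n)"
  have "accepted (\<lambda>_. n) = entries" unfolding accepted_def entries_def ..
  then have "int (card entries) = taken (\<lambda>_. n)"
    using card_prefixes[of "\<lambda>_. n"] lo_le by force
  also have "\<dots> \<le> (\<Sum>w<m. (hi w - lo w + 1) + (s - 1))"
    unfolding taken_def by (rule sum_mono) (use c in force)
  also have "\<dots> = taken hi + int m * (s - 1)"
    unfolding taken_def by (simp add: sum.distrib sum_subtractf algebra_simps)
  finally show False using room k by linarith
qed

text \<open>Ranks are distinct, so at most \<open>k\<close> entries have rank below
  \<open>k\<close>. Once \<open>k\<close> entries are accepted they are all of these, and that set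
  is closed under predecessors.\<close>

lemma accepted_closed:
  assumes g: "good hi" and t: "taken hi = int k"
    and x: "x \<in> accepted hi" and y: "y \<in> entries" "bef y x"
  shows "y \<in> accepted hi"
proof -
  let ?T = "{z \<in> entries. rank z < k}"
  have "inj_on rank ?T"
    by (rule inj_onI) (metis (no_types, lifting) bef_total mem_Collect_eq nat_neq_iff rank_strict)
  moreover have "rank ` ?T \<subseteq> {..<k}" by auto
  ultimately have "card ?T \<le> card {..<k}"
    by (rule card_inj_on_le) simp
  moreover have "accepted hi \<subseteq> ?T"
    using g accepted_subset[OF g] unfolding good_def by auto
  moreover have "card (accepted hi) = k"
    using card_accepted[OF g] t by simp
  ultimately have "accepted hi = ?T"
    by (intro card_seteq) auto
  then show ?thesis using x y rank_mono[OF y(2)] by auto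
qed

end

section \<open>Young diagrams, and the lists as parts of the matrix\<close>

lemma is_staircase_young:
  assumes fin: "finite S"
    and pos: "\<And>i j. (i, j) \<in> S \<Longrightarrow> 1 \<le> i \<and> 1 \<le> j"
    and young: "\<And>i j i' j'. (i, j) \<in> S \<Longrightarrow> 1 \<le> i' \<Longrightarrow> i' \<le> i \<Longrightarrow> 1 \<le> j' \<Longrightarrow> j' \<le> j \<Longrightarrow> (i', j') \<in> S"
  shows "is_staircase S"
proof -
  have finr: "finite (row_slice S i)" for i
  proof (rule finite_subset)
    show "row_slice S i \<subseteq> snd ` S" unfolding row_slice_def by force
  qed (use fin in auto)
  have ne: "row_slice S i' \<noteq> {}" if "row_slice S i \<noteq> {}" "1 \<le> i'" "i' \<le> i" for i i'
  proof -
    from that(1) obtain j where j: "(i, j) \<in> S" unfolding row_slice_def by auto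
    have "(i', j) \<in> S" by (rule young[OF j that(2,3)]) (use pos[OF j] in auto)
    then show ?thesis unfolding row_slice_def by auto
  qed
  have pos_row: "1 \<le> i" if "row_slice S i \<noteq> {}" for i
    using that pos unfolding row_slice_def by auto
  \<comment> \<open>All nonempty rows of a Young diagram start in column 1, so the start indices are
    constant; only the ends vary.\<close>
  have min: "Min (row_slice S i) = 1" if "row_slice S i \<noteq> {}" for i
  proof (rule Min_eqI[OF finr])
    from that obtain j where j: "(i, j) \<in> S" unfolding row_slice_def by auto
    have "(i, 1) \<in> S" by (rule young[OF j]) (use pos[OF j] in auto)
    then show "1 \<in> row_slice S i" unfolding row_slice_def by auto
  qed (use pos in \<open>auto simp: row_slice_def\<close>)
  have max: "Max (row_slice S (i + 1)) \<le> Max (row_slice S i)" if n: "row_slice S (i + 1) \<noteq> {}"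
    and n': "row_slice S i \<noteq> {}" for i
  proof (rule Max_mono[OF _ n finr])
    show "row_slice S (i + 1) \<subseteq> row_slice S i"
    proof
      fix j assume "j \<in> row_slice S (i + 1)"
      then have j: "(i + 1, j) \<in> S" unfolding row_slice_def by auto
      have "(i, j) \<in> S" by (rule young[OF j]) (use pos[OF j] pos_row[OF n'] in auto)
      then show "j \<in> row_slice S i" unfolding row_slice_def by auto
    qed
  qed
  show ?thesis
    unfolding is_staircase_def
  proof (intro conjI allI impI)
    fix i j1 j2 j assume a: "(i, j1) \<in> S" "(i, j2) \<in> S" "j1 \<le> j" "j \<le> j2"
    show "(i, j) \<in> S" by (rule young[OF a(2)]) (use a pos[OF a(1)] in auto)
  next
    fix i1 i2 i assume a: "row_slice S i1 \<noteq> {}" "row_slice S i2 \<noteq> {}" "i1 \<le> i" "i \<le> i2"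
    show "row_slice S i \<noteq> {}" by (rule ne[OF a(2)]) (use a pos_row[OF a(1)] in auto)
  qed (use fin min max in auto)
qed

text \<open>The \<open>k\<close> largest sums lie in the first \<open>r\<close> rows and columns when \<open>k \<le> r * r\<close>. List \<open>w < r\<close> is
  row \<open>w + 1\<close>, list \<open>r + j - 1\<close> is the part of column \<open>j\<close> below row \<open>r\<close>.\<close>

definition list_lo :: "nat \<Rightarrow> nat \<Rightarrow> int" where
  "list_lo r w = (if w < r then 1 else int r + 1)"

definition list_pos :: "nat \<Rightarrow> nat \<Rightarrow> int \<Rightarrow> int \<times> int" where
  "list_pos r w p = (if w < r then (int w + 1, p) else (p, int w - int r + 1))"

definition list_val :: "(nat \<Rightarrow> real) \<Rightarrow> (nat \<Rightarrow> real) \<Rightarrow> nat \<Rightarrow> nat \<Rightarrow> int \<Rightarrow> real" where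
  "list_val A B r w p = Mval A B (list_pos r w p)"

text \<open>The minimality of \<open>r\<close> enters elsewhere, where \<open>r \<le> n\<close> and
  the time bounds are derived.\<close>

locale sorted_arrays =
  fixes A B :: "nat \<Rightarrow> real" and n k r :: nat
  assumes A: "sorted_noninc A n" and B: "sorted_noninc B n"
    and r: "k \<le> r * r" "r \<le> n"
begin

lemma Mval_mono:
  assumes "1 \<le> i" "i \<le> i'" "i' \<le> int n" "1 \<le> j" "j \<le> j'" "j' \<le> int n"
  shows "Mval A B (i', j') \<le> Mval A B (i, j)"
proof -
  have "A (nat i') \<le> A (nat i)" "B (nat j') \<le> B (nat j)"
    using A B assms unfolding sorted_noninc_def by auto
  then show ?thesis unfolding Mval_def by simp
qed

sublocale sorted_lists "2 * r" "int n" "list_lo r" "list_val A B r" k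
proof
  fix w p q
  show "w < 2 * r \<Longrightarrow> list_lo r w \<le> p \<Longrightarrow> p \<le> q \<Longrightarrow> q \<le> int n \<Longrightarrow> list_val A B r w q \<le> list_val A B r w p"
    using r by (auto simp: list_val_def list_lo_def list_pos_def intro!: Mval_mono split: if_splits)
  show "w < 2 * r \<Longrightarrow> list_lo r w \<le> int n + 1"
    using r by (auto simp: list_lo_def)
qed

text \<open>The row lists already contain the leading \<open>r \<times> r\<close> square. This keeps
  the supply of entries from running out in \<open>exists_long_list\<close>.\<close>

lemma card_entries: "k \<le> card entries"
proof -
  have "inj_on (\<lambda>(a, b). (a, int b + 1)) ({..<r} \<times> {..<r})" by (auto simp: inj_on_def)
  moreover have "(\<lambda>(a, b). (a, int b + 1)) ` ({..<r} \<times> {..<r}) \<subseteq> entries"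
    using r unfolding entries_def list_lo_def by auto
  ultimately have "card ({..<r} \<times> {..<r}) \<le> card entries"
    by (rule card_inj_on_le) simp
  then show ?thesis using r by simp
qed

definition selected :: "(nat \<Rightarrow> int) \<Rightarrow> (int \<times> int) set" where
  "selected hi = (\<lambda>(w, p). list_pos r w p) ` accepted hi"

lemma inj_list_pos: "inj_on (\<lambda>(w, p). list_pos r w p) entries"
  unfolding inj_on_def entries_def list_pos_def list_lo_def by (auto split: if_splits)

lemma list_pos_surj:
  assumes "(i, j) \<in> grid n" "i \<le> int r \<or> j \<le> int r"
  shows "\<exists>w p. (w, p) \<in> entries \<and> list_pos r w p = (i, j)"
proof (cases "i \<le> int r")
  case True
  with assms show ?thesis
    by (intro exI[of _ "nat (i - 1)"] exI[of _ j]) (auto simp: grid_def entries_def list_pos_def list_lo_def)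
next
  case False
  with assms show ?thesis
    by (intro exI[of _ "r + nat (j - 1)"] exI[of _ i]) (auto simp: grid_def entries_def list_pos_def list_lo_def)
qed

lemma list_pos_grid: "(w, p) \<in> entries \<Longrightarrow> list_pos r w p \<in> grid n"
  using r unfolding entries_def list_pos_def list_lo_def grid_def by (auto split: if_splits)

context
  fixes hi
  assumes g: "good hi" and t: "taken hi = int k"
begin

lemma card_selected: "card (selected hi) = k"
proof -
  have "card (selected hi) = card (accepted hi)"
    unfolding selected_def by (rule card_image[OF inj_on_subset[OF inj_list_pos accepted_subset[OF g]]])
  then show ?thesis using card_accepted[OF g] t by simp
qed

lemma selected_grid: "selected hi \<subseteq> grid n"
  unfolding selected_def using list_pos_grid accepted_subset[OF g] by auto

text \<open>Breaking ties by the list index makes the order of the entries a linear extension of the dominance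
  order on the matrix.\<close>

lemma selected_young:
  assumes ij: "(i, j) \<in> selected hi" and le: "1 \<le> i'" "i' \<le> i" "1 \<le> j'" "j' \<le> j"
  shows "(i', j') \<in> selected hi"
proof -
  obtain w p where wp: "(w, p) \<in> accepted hi" "list_pos r w p = (i, j)"
    using ij unfolding selected_def by auto
  then have e: "(w, p) \<in> entries" using accepted_subset[OF g] by auto
  have ij_grid: "(i, j) \<in> grid n" using ij selected_grid by auto
  have "i \<le> int r \<or> j \<le> int r"
    using wp(2) e unfolding list_pos_def entries_def by (auto split: if_splits)
  with le ij_grid have "(i', j') \<in> grid n" "i' \<le> int r \<or> j' \<le> int r"
    unfolding grid_def by auto
  from list_pos_surj[OF this] obtain w' p' where
    w': "(w', p') \<in> entries" "list_pos r w' p' = (i', j')" by auto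
  have "Mval A B (i, j) \<le> Mval A B (i', j')"
    by (rule Mval_mono) (use le ij_grid in \<open>auto simp: grid_def\<close>)
  then have v: "list_val A B r w p \<le> list_val A B r w' p'"
    unfolding list_val_def using wp(2) w'(2) by simp
  \<comment> \<open>Rows are numbered before columns. Moving up or left from a row list leads to an
    earlier row or further left in the same row; from a column list it leads to a row list, an
    earlier column or higher up in the same column.\<close>
  have "w' < w \<or> w' = w \<and> p' \<le> p"
    using wp(2) w' e le unfolding list_pos_def entries_def list_lo_def
    by (auto split: if_splits)
  then have "(w', p') = (w, p) \<or> bef (w', p') (w, p)"
    using v unfolding bef_def by auto
  then have "(w', p') \<in> accepted hi"
    using accepted_closed[OF g t wp(1) w'(1)] wp(1) by auto
  then show ?thesis unfolding selected_def using w'(2) by force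
qed

lemma staircase_selected: "is_staircase (selected hi)"
proof (rule is_staircase_young)
  show "finite (selected hi)" unfolding selected_def by simp
  show "\<And>i j. (i, j) \<in> selected hi \<Longrightarrow> 1 \<le> i \<and> 1 \<le> j"
    using selected_grid unfolding grid_def by auto
qed (use selected_young in blast)

lemma selected_if_larger:
  assumes p: "p \<in> selected hi" and q: "q \<in> grid n" "fst q \<le> int r \<or> snd q \<le> int r"
    and lt: "Mval A B p < Mval A B q"
  shows "q \<in> selected hi"
proof -
  obtain x where x: "x \<in> accepted hi" "p = list_pos r (fst x) (snd x)"
    using p unfolding selected_def by auto
  obtain y where y: "y \<in> entries" "q = list_pos r (fst y) (snd y)"
    using list_pos_surj[of "fst q" "snd q"] q by auto
  have "bef y x" using lt x y unfolding bef_def list_val_def by auto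
  from accepted_closed[OF g t x(1) y(1) this] show ?thesis
    unfolding selected_def using y(2) by force
qed

text \<open>A larger entry \<open>q\<close> that was left out must have row and column beyond
  \<open>r\<close>. Then all \<open>r * r\<close> entries of the leading square are at least
  \<open>q\<close>, hence larger than \<open>p\<close> and selected; together with \<open>p\<close>
  these are more than \<open>k\<close>.\<close>

lemma top_k_selected: "top_k A B n k (selected hi)"
  unfolding top_k_def
proof (intro conjI ballI selected_grid card_selected)
  fix p q assume p: "p \<in> selected hi" and q: "q \<in> grid n - selected hi"
  show "Mval A B q \<le> Mval A B p"
  proof (rule ccontr)
    assume lt: "\<not> Mval A B q \<le> Mval A B p"
    with selected_if_larger[OF p, of q] q have far: "int r < fst q" "int r < snd q" by force+
    have sub: "{1..int r} \<times> {1..int r} \<subseteq> selected hi - {p}"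
    proof clarify
      fix i j assume ij: "i \<in> {1..int r}" "j \<in> {1..int r}"
      have "Mval A B q \<le> Mval A B (i, j)"
        using Mval_mono[of i "fst q" j "snd q"] ij far q by (auto simp: grid_def)
      then have "Mval A B p < Mval A B (i, j)" using lt by simp
      moreover from this have "(i, j) \<in> selected hi"
        by (intro selected_if_larger[OF p]) (use ij r in \<open>auto simp: grid_def\<close>)
      ultimately show "(i, j) \<in> selected hi - {p}" by auto
    qed
    have fin: "finite (selected hi)" unfolding selected_def by simp
    have "r * r = card ({1..int r} \<times> {1..int r})" by simp
    also have "\<dots> \<le> card (selected hi - {p})" by (rule card_mono[OF _ sub]) (use fin in simp)
    also have "\<dots> < card (selected hi)" using fin p by (intro psubset_card_mono) auto
    finally show False using card_selected r by simp
  qed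
qed

end

end

section \<open>The tournament tree\<close>

text \<open>The nesting mirrors the tests of \<open>pick\<close>, where equality of reals is decided
  by two comparisons.\<close>

definition winner :: "real \<times> int \<Rightarrow> real \<times> int \<Rightarrow> real \<times> int" where
  "winner x y = (if fst x \<le> fst y then if fst y \<le> fst x then if snd x \<le> snd y then x else y else y else x)"

definition beats :: "real \<times> int \<Rightarrow> real \<times> int \<Rightarrow> bool" where
  "beats x y \<longleftrightarrow> fst y < fst x \<or> fst x = fst y \<and> snd x \<le> snd y"

definition node_ok :: "(nat \<Rightarrow> real \<times> int) \<Rightarrow> nat \<Rightarrow> bool" where
  "node_ok N v \<longleftrightarrow> N v = winner (N (2 * v)) (N (2 * v + 1))"

text \<open>Node \<open>v\<close> has the children \<open>2 * v\<close> and \<open>2 * v + 1\<close>, the leaves are \<open>m, \<dots>, 2 * m - 1\<close>; \<open>m\<close> need not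
  be a power of two.\<close>

definition tournament :: "nat \<Rightarrow> (nat \<Rightarrow> real \<times> int) \<Rightarrow> bool" where
  "tournament m N \<longleftrightarrow> (\<forall>v. 1 \<le> v \<longrightarrow> v < m \<longrightarrow> node_ok N v)"

text \<open>Inner nodes copy a child, and children have larger numbers, so the descent ends at a
  leaf. At the root this identifies the list to accept from.\<close>

lemma tournament_leaf:
  assumes "tournament m N" "1 \<le> v" "v < 2 * m"
  shows "\<exists>w<m. N v = N (m + w)"
  using assms(2,3)
proof (induction "2 * m - v" arbitrary: v rule: less_induct)
  case less
  show ?case
  proof (cases "v < m")
    case True
    then have "N v = winner (N (2 * v)) (N (2 * v + 1))"
      using assms(1) less.prems unfolding tournament_def node_ok_def by auto
    then have "N v = N (2 * v) \<or> N v = N (2 * v + 1)"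
      unfolding winner_def by (auto split: if_splits)
    moreover have "\<exists>w<m. N (2 * v) = N (m + w)" by (rule less.hyps) (use True less.prems in auto)
    moreover have "\<exists>w<m. N (2 * v + 1) = N (m + w)" by (rule less.hyps) (use True less.prems in auto)
    ultimately show ?thesis by auto
  next
    case False
    then show ?thesis using less.prems by (intro exI[of _ "v - m"]) auto
  qed
qed

lemma beats_trans: "beats x y \<Longrightarrow> beats y z \<Longrightarrow> beats x z"
  unfolding beats_def by auto

lemma beats_winner: "beats (winner x y) x" "beats (winner x y) y"
  unfolding beats_def winner_def by auto

text \<open>Every parent beats its children, and halving leads from any node up to 1.\<close>

lemma tournament_root_beats:
  assumes "tournament m N" "1 \<le> v" "v < 2 * m"
  shows "beats (N 1) (N v)"
  using assms(2,3)
proof (induction v rule: less_induct)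
  case (less v)
  show ?case
  proof (cases "v = 1")
    case False
    then have "beats (N 1) (N (v div 2))" using less by auto
    moreover have "node_ok N (v div 2)"
      using assms(1) less.prems False unfolding tournament_def by auto
    then have "beats (N (v div 2)) (N v)"
      unfolding node_ok_def using beats_winner by (cases "even v") (auto elim!: evenE oddE)
    ultimately show ?thesis using beats_trans by blast
  qed (auto simp: beats_def)
qed

text \<open>The tree is a pair of parallel arrays at the same addresses, values in the real memory
  and list indices in the integer memory.\<close>

definition nodes :: "nat \<Rightarrow> (nat \<Rightarrow> int) \<Rightarrow> (nat \<Rightarrow> real) \<Rightarrow> nat \<Rightarrow> real \<times> int" where
  "nodes b i r v = (r (b + v), i (b + v))"

text \<open>Cells 2 and 24 hold the left child, 3 and 25 the right one. The only direct way to move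
  a real is through memory, so a winning right child is loaded again from its address in cell
  23.\<close>

definition pick :: com where
  "pick = Choose (LeR 2 3)
     (Choose (LeR 3 2) (Choose (LeI 24 25) (Blk []) (Blk [RLoad 2 23, ILoad 24 23])) (Blk [RLoad 2 23, ILoad 24 23]))
     (Blk [])"

lemma wp_pick:
  assumes "r 3 = r (nat (i 23))" "i 25 = i (nat (i 23))"
    and Q: "\<And>\<tau>'. \<tau>' \<le> \<tau> + 8 \<Longrightarrow>
      Q \<tau>' (i(24 := snd (winner (r 2, i 24) (r 3, i 25)))) (r(2 := fst (winner (r 2, i 24) (r 3, i 25))))"
  shows "wp A B pick Q \<tau> i r"
  unfolding pick_def
  by (intro wp_Choose wp_Blk)
    (use assms(1,2) Q[of "Suc (Suc \<tau>)"] Q[of "Suc (Suc (Suc \<tau>))"] Q[of "Suc (Suc (Suc (Suc (Suc \<tau>))))"]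
      Q[of "Suc (Suc (Suc (Suc (Suc (Suc \<tau>)))))"] in \<open>auto simp: winner_def\<close>)

definition climb :: com where
  "climb = Blk [IDiv 22 22 12] ;; Loop (LeI 2 22)
     (Blk [IMul 23 22 12, IAdd 23 23 5, RLoad 2 23, ILoad 24 23, IAdd 23 23 2, RLoad 3 23, ILoad 25 23] ;;
      pick ;;
      Blk [IAdd 26 5 22, IStore 26 24, RStore 26 2, IDiv 22 22 12])"

text \<open>At any time only the node in cell 22 may violate its equation. Recomputing it can only
  spoil its parent, and \<open>u < 2 ^ l\<close> bounds the number of halvings.\<close>

lemma wp_climb:
  assumes regs: "i 2 = 1" "i 12 = 2" "i 5 = int b" "i 22 = int u" and b: "33 \<le> b"
    and u: "1 \<le> u" "u < 2 * m" "u < 2 ^ l"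
    and ok: "\<And>v. 1 \<le> v \<Longrightarrow> v < m \<Longrightarrow> v \<noteq> u div 2 \<Longrightarrow> node_ok (nodes b i r) v"
    and Q: "\<And>\<tau>' i' r'. \<tau>' \<le> \<tau> + 25 * l + 10 \<Longrightarrow> tournament m (nodes b i' r') \<Longrightarrow>
      (\<And>a. a < b \<Longrightarrow> a < 22 \<or> 26 < a \<Longrightarrow> i' a = i a) \<Longrightarrow>
      (\<And>w. w < m \<Longrightarrow> nodes b i' r' (m + w) = nodes b i r (m + w)) \<Longrightarrow> Q \<tau>' i' r'"
  shows "wp A B climb Q \<tau> i r"
proof -
  define T where "T = \<tau> + 25 * l + 8"
  define Inv where "Inv \<tau>' i' r' \<longleftrightarrow> (\<exists>v l'. i' 22 = int v \<and> v < m \<and> v < 2 ^ l' \<and> \<tau>' + 25 * l' \<le> T \<and>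
      (\<forall>a. a < b \<longrightarrow> a < 22 \<or> 26 < a \<longrightarrow> i' a = i a) \<and>
      (\<forall>w<m. nodes b i' r' (m + w) = nodes b i r (m + w)) \<and>
      (\<forall>v'. 1 \<le> v' \<longrightarrow> v' < m \<longrightarrow> v' \<noteq> v \<longrightarrow> node_ok (nodes b i' r') v'))"
    for \<tau>' :: nat and i' :: "nat \<Rightarrow> int" and r' :: "nat \<Rightarrow> real"
  show ?thesis
    unfolding climb_def
  proof (intro wp_Seq wp_Blk, simp, simp, rule wp_Loop[where Inv = Inv and T = T])
    have "int u div 2 = int (u div 2)" by simp
    moreover have "nodes b (i(22 := x)) r = nodes b i r" for x
      unfolding nodes_def using b by auto
    ultimately show "Inv (Suc \<tau>) (i(22 := i 22 div i 12)) r"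
      unfolding Inv_def using regs u ok b
      by (intro exI[of _ "u div 2"] exI[of _ l]) (auto simp: T_def)
  next
    show "Inv \<tau>' i' r' \<Longrightarrow> \<tau>' \<le> T" for \<tau>' i' r'
      unfolding Inv_def by auto
  next
    \<comment> \<open>On exit the exempt node is 0, which lies outside the tree, so all inner nodes
      are correct.\<close>
    fix \<tau>' i' r' assume "Inv \<tau>' i' r'" "\<not> holds (LeI 2 22) i' r'"
    moreover have "i' 2 = 1" if "Inv \<tau>' i' r'" using that regs b unfolding Inv_def by auto
    ultimately show "Q (\<tau>' + 2) i' r'"
      unfolding Inv_def by (auto intro!: Q simp: tournament_def T_def)
  next
    fix \<tau>' i' r' assume I: "Inv \<tau>' i' r'" and h: "holds (LeI 2 22) i' r'"
    then obtain v l' where v: "i' 22 = int v" "v < m" "v < 2 ^ l'" "\<tau>' + 25 * l' \<le> T"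
      and fr: "\<And>a. a < b \<Longrightarrow> a < 22 \<or> 26 < a \<Longrightarrow> i' a = i a"
      and lf: "\<And>w. w < m \<Longrightarrow> nodes b i' r' (m + w) = nodes b i r (m + w)"
      and ok': "\<And>v'. 1 \<le> v' \<Longrightarrow> v' < m \<Longrightarrow> v' \<noteq> v \<Longrightarrow> node_ok (nodes b i' r') v'"
      unfolding Inv_def by blast
    have regs': "i' 2 = 1" "i' 12 = 2" "i' 5 = int b" using fr regs b by auto
    have v1: "1 \<le> v" using h v(1) regs' by simp
    then obtain l'' where l'': "l' = Suc l''" using v(3) by (cases l') auto
    have a1: "nat (int v * 2 + int b) = b + 2 * v" "nat (int v * 2 + int b + 1) = b + (2 * v + 1)" by auto
    have ne: "(b + x = c) = False" "(b = c) = False" if "c < 33" for x c :: nat using that b by auto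
    let ?N = "nodes b i' r'"
    define W where "W = winner (r' (b + 2 * v), i' (b + 2 * v)) (r' (Suc (b + 2 * v)), i' (Suc (b + 2 * v)))"
    have upd: "nodes b (i'(23 := x1, 25 := x2, 24 := x3, 26 := x4, b + v := snd W, 22 := x5))
        (r'(3 := y1, 2 := y2, b + v := fst W)) = ?N(v := W)" for x1 x2 x3 x4 x5 y1 y2
      unfolding nodes_def by (auto simp: ne fun_eq_iff)
    have W: "W = winner (?N (2 * v)) (?N (2 * v + 1))" unfolding W_def nodes_def by simp
    \<comment> \<open>Writing node \<open>v\<close> repairs its own equation; the only other
      equation mentioning it is that of \<open>v div 2\<close>.\<close>
    have okW: "node_ok (?N(v := W)) v'" if "1 \<le> v'" "v' < m" "v' \<noteq> v div 2" for v'
    proof (cases "v' = v")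
      case False
      moreover have "2 * v' \<noteq> v" "2 * v' + 1 \<noteq> v" using that(3) by auto
      ultimately show ?thesis using ok'[OF that(1,2)] unfolding node_ok_def by simp
    qed (use v1 W in \<open>auto simp: node_ok_def\<close>)
    have lfW: "(?N(v := W)) (m + w) = nodes b i r (m + w)" if "w < m" for w
      using lf[OF that] v(2) by auto
    show "wp A B (Blk [IMul 23 22 12, IAdd 23 23 5, RLoad 2 23, ILoad 24 23, IAdd 23 23 2, RLoad 3 23, ILoad 25 23] ;;
      pick ;; Blk [IAdd 26 5 22, IStore 26 24, RStore 26 2, IDiv 22 22 12])
      (\<lambda>\<tau>. Inv (\<tau> + 1)) (\<tau>' + 1) i' r'"
      apply (rule wp_Seq, rule wp_Blk, simp)
      apply (simp add: regs' v(1) a1 ne)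
      apply (rule wp_Seq, rule wp_pick)
      subgoal by (simp add: a1 ne)
      subgoal by (simp add: a1 ne)
      apply (rule wp_Blk, simp)
      apply (simp add: regs' v(1) nat_int_add ne)
      apply (fold W_def)
      apply (unfold Inv_def upd, rule exI[of _ "v div 2"], rule exI[of _ l''], intro conjI)
      subgoal by simp
      subgoal using v by simp
      subgoal using v l'' by simp
      subgoal using v l'' by simp
      subgoal using fr by (auto simp: ne)
      subgoal using lfW by blast
      subgoal using okW by blast
      done
  qed
qed

section \<open>The selection program\<close>

text \<open>Integer cells: 0 \<open>n\<close>, 1 \<open>k\<close>, 3 \<open>r\<close>, 4 \<open>2 * r\<close>, 5 the base of the tree (also in the real memory), 6 the
  step width, 7 the number of entries still to be accepted, 8 the current list, 9 \<open>2 * r - 1\<close>, 10 the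
  bound above which the phase goes on, 16 the address of the root; 2, 11 to 15 and 17 hold the
  constants 1, 4, 2, 0, 33, 36 and 8, and 20 to 32 are scratch cells. List \<open>w\<close> is stored in the cells from
  \<open>33 + 4 * w\<close> on, in the format of an output descriptor.\<close>

definition load_leaf :: com where
  "load_leaf = Blk [IMul 20 8 11, IAdd 20 20 14, ILoad 21 20, IAdd 20 20 2, ILoad 23 20, IAdd 20 20 12,
       ILoad 24 20, IAdd 25 24 6] ;;
     Choose (LeI 25 0)
       (Choose (LeI 21 13) (Blk [RReadA 2 23, RReadB 3 25]) (Blk [RReadA 2 25, RReadB 3 23]) ;;
        Blk [IAdd 27 8 13])
       (Blk [RReadA 2 0, RReadB 3 0, IAdd 27 8 4]) ;;
     Blk [RAdd 2 2 3, IAdd 22 4 8, IAdd 26 5 22, IStore 26 27, RStore 26 2]"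

definition update :: com where
  "update = load_leaf ;; climb"

text \<open>A new width changes every leaf. Separate updates cost a logarithmic factor more than
  rebuilding the tree, but no more than the acceptances of the phase in order of magnitude.\<close>

definition refresh :: com where
  "refresh = Blk [ISub 8 2 2] ;; Loop (LeI 8 9) (update ;; Blk [IAdd 8 8 2])"

text \<open>Cell 10 holds \<open>2 * r * (s - 1) + 1\<close>, which turns the strict test for enough
  remaining entries into \<open>\<le>\<close>. The index at the root names the list to
  advance.\<close>

definition accept :: com where
  "accept = Blk [ISub 10 6 2, IMul 10 10 4, IAdd 10 10 2] ;;
     Loop (LeI 10 7)
       (Blk [ILoad 8 16, IMul 20 8 11, IAdd 20 20 15, ILoad 21 20, IAdd 21 21 6, IStore 20 21, ISub 7 7 6] ;;
        update)"

definition phases :: com where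
  "phases = Loop (LeI 2 6) (refresh ;; accept ;; Blk [IDiv 6 6 12])"

text \<open>The nodes of a tree with \<open>2 * r\<close> leaves are numbered below
  \<open>4 * r\<close>, so \<open>l\<close> bounds its height.\<close>

locale selection = sorted_arrays +
  fixes l :: nat
  assumes r_pos: "1 \<le> r" and l: "4 * r \<le> 2 ^ l"
begin

definition base :: nat where "base = 33 + 8 * r"

text \<open>List \<open>w\<close> is descriptor \<open>w + 8\<close> of \<open>decode\<close>, since
  \<open>4 * (w + 8) + 1 = 33 + 4 * w\<close>.\<close>

definition desc_ok :: "(nat \<Rightarrow> int) \<Rightarrow> (nat \<Rightarrow> int) \<Rightarrow> nat \<Rightarrow> bool" where
  "desc_ok hi i w \<longleftrightarrow> i (33 + 4 * w) = (if w < r then 0 else 1) \<and>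
     i (34 + 4 * w) = (if w < r then int w + 1 else int w - int r + 1) \<and>
     i (35 + 4 * w) = list_lo r w \<and> i (36 + 4 * w) = hi w"

definition layout :: "(nat \<Rightarrow> int) \<Rightarrow> (nat \<Rightarrow> int) \<Rightarrow> bool" where
  "layout hi i \<longleftrightarrow> i 0 = int n \<and> i 1 = int k \<and> i 2 = 1 \<and> i 4 = 2 * int r \<and> i 5 = int base \<and>
     i 9 = 2 * int r - 1 \<and> i 11 = 4 \<and> i 12 = 2 \<and> i 13 = 0 \<and> i 14 = 33 \<and> i 15 = 36 \<and>
     i 16 = int base + 1 \<and> i 17 = 8 \<and> (\<forall>w<2 * r. desc_ok hi i w)"

text \<open>An exhausted list competes with the smallest entry of the matrix and an index beyond all
  lists, so that it loses against every other list.\<close>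

definition leaf :: "int \<Rightarrow> (nat \<Rightarrow> int) \<Rightarrow> nat \<Rightarrow> real \<times> int" where
  "leaf s hi w = (if hi w + s \<le> int n then (list_val A B r w (hi w + s), int w)
     else (A n + B n, int w + 2 * int r))"

definition frame :: "(nat \<Rightarrow> int) \<Rightarrow> (nat \<Rightarrow> int) \<Rightarrow> bool" where
  "frame i i' \<longleftrightarrow> (\<forall>a<base. a < 20 \<or> 32 < a \<longrightarrow> i' a = i a)"

lemma layout_frame: "layout hi i \<Longrightarrow> frame i i' \<Longrightarrow> layout hi i'"
  unfolding layout_def desc_ok_def frame_def base_def by auto

lemma base_neq: "(base + x = c) = False" "(base = c) = False" if "c < 33" for x c :: nat
  using that unfolding base_def by auto

lemma layoutD:
  assumes "layout hi i"
  shows "i 0 = int n" "i (Suc 0) = int k" "i 2 = 1" "i 4 = 2 * int r" "i 5 = int base"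
     "i 9 = 2 * int r - 1" "i 11 = 4" "i 12 = 2" "i 13 = 0" "i 14 = 33" "i 15 = 36"
     "i 16 = int base + 1" "i 17 = 8"
     "w < 2 * r \<Longrightarrow> i (33 + 4 * w) = (if w < r then 0 else 1)"
     "w < 2 * r \<Longrightarrow> i (34 + 4 * w) = (if w < r then int w + 1 else int w - int r + 1)"
     "w < 2 * r \<Longrightarrow> i (36 + 4 * w) = hi w"
  using assms unfolding layout_def desc_ok_def by auto

lemma wp_load_leaf:
  assumes lay: "layout hi i" and s: "i 6 = s" and w: "i 8 = int w" "w < 2 * r"
    and Q: "\<And>\<tau>' i' re'. \<tau>' \<le> \<tau> + 30 \<Longrightarrow> frame i i' \<Longrightarrow> i' 22 = int (2 * r + w) \<Longrightarrow>
      nodes base i' re' = (nodes base i re)(2 * r + w := leaf s hi w) \<Longrightarrow> Q \<tau>' i' re'"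
  shows "wp A B load_leaf Q \<tau> i re"
proof -
  \<comment> \<open>Names for the cell contents keep the distinction between rows and columns out of
    the symbolic execution until the leaf is compared.\<close>
  define kd where "kd = i (33 + 4 * w)"
  define a where "a = i (34 + 4 * w)"
  have desc: "i (33 + 4 * w) = kd" "i (34 + 4 * w) = a" "i (36 + 4 * w) = hi w"
    using layoutD(16)[OF lay w(2)] by (simp_all add: kd_def a_def)
  have kd: "kd = (if w < r then 0 else 1)" "a = (if w < r then int w + 1 else int w - int r + 1)"
    using layoutD(14,15)[OF lay w(2)] by (simp_all add: kd_def a_def)
  note reg = layoutD(1-13)[OF lay] base_neq desc
  have ad: "nat (33 + int w * 4) = 33 + 4 * w" "nat (34 + int w * 4) = 34 + 4 * w" "nat (36 + int w * 4) = 36 + 4 * w"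
    "nat (int w * 4 + 33) = 33 + 4 * w"
    "nat (int base + (2 * int r + int w)) = base + (2 * r + w)"
    by auto
  show ?thesis
    unfolding load_leaf_def
    apply (rule wp_Seq, rule wp_Blk, simp)
    apply (simp add: reg w s ad)
    apply (rule wp_Seq, rule wp_Choose)
    apply (rule wp_Seq, rule wp_Choose)
    apply (rule wp_Blk, simp)
    apply (simp add: reg w s ad)
    apply (rule wp_Blk, simp)
    apply (simp add: reg w s ad)
    apply (rule wp_Blk, simp)
    apply (simp add: reg w s ad)
    apply (rule Q)
    subgoal by (simp add: base_neq)
    subgoal by (simp add: frame_def base_def)
    subgoal by (simp add: base_neq)
    subgoal by (auto simp: nodes_def fun_eq_iff leaf_def list_val_def list_pos_def Mval_def kd reg split: if_splits)
    apply (rule wp_Blk, simp)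
    apply (simp add: reg w s ad)
    apply (rule wp_Blk, simp)
    apply (simp add: reg w s ad)
    apply (rule wp_Blk, simp)
    apply (simp add: reg w s ad)
    apply (rule Q)
    subgoal by (simp add: base_neq)
    subgoal by (simp add: frame_def base_def)
    subgoal by (simp add: base_neq)
    subgoal by (auto simp: nodes_def fun_eq_iff leaf_def list_val_def list_pos_def Mval_def kd reg split: if_splits)
    apply (rule wp_Blk, simp)
    apply (simp add: reg w s ad)
    apply (rule wp_Blk, simp)
    apply (simp add: reg w s ad)
    apply (rule Q)
    subgoal by (simp add: base_neq)
    subgoal by (simp add: frame_def base_def)
    subgoal by (simp add: base_neq)
    subgoal by (auto simp: nodes_def fun_eq_iff leaf_def list_val_def list_pos_def Mval_def kd reg split: if_splits)
    done
qed

text \<open>The tree is valid from the beginning, when all nodes are zero, and a new leaf only invalidates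
  ancestors, which the update repairs. So the tree needs no separate construction.\<close>

lemma wp_update:
  assumes lay: "layout hi i" and s: "i 6 = s" and w: "i 8 = int w" "w < 2 * r"
    and tree: "tournament (2 * r) (nodes base i re)"
    and Q: "\<And>\<tau>' i' re'. \<tau>' \<le> \<tau> + 25 * l + 50 \<Longrightarrow> layout hi i' \<Longrightarrow> frame i i' \<Longrightarrow>
      tournament (2 * r) (nodes base i' re') \<Longrightarrow>
      nodes base i' re' (2 * r + w) = leaf s hi w \<Longrightarrow>
      (\<And>w'. w' < 2 * r \<Longrightarrow> w' \<noteq> w \<Longrightarrow> nodes base i' re' (2 * r + w') = nodes base i re (2 * r + w')) \<Longrightarrow>
      Q \<tau>' i' re'"
  shows "wp A B update Q \<tau> i re"
  unfolding update_def
proof (rule wp_Seq, rule wp_load_leaf[OF lay s w])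
  fix \<tau>1 i1 re1
  assume a: "\<tau>1 \<le> \<tau> + 30" "frame i i1" "i1 22 = int (2 * r + w)"
    "nodes base i1 re1 = (nodes base i re)(2 * r + w := leaf s hi w)"
  note lay1 = layout_frame[OF lay a(2)]
  show "wp A B climb Q \<tau>1 i1 re1"
  proof (rule wp_climb[OF layoutD(3)[OF lay1] layoutD(8)[OF lay1] layoutD(5)[OF lay1] a(3)])
    show "2 * r + w < 2 * (2 * r)" "1 \<le> 2 * r + w" "33 \<le> base" using w r_pos by (auto simp: base_def)
    then show "2 * r + w < 2 ^ l" using l by linarith
    show "node_ok (nodes base i1 re1) v" if "1 \<le> v" "v < 2 * r" "v \<noteq> (2 * r + w) div 2" for v
    proof -
      have "2 * v \<noteq> 2 * r + w" "2 * v + 1 \<noteq> 2 * r + w" using that(3) by auto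
      then show ?thesis
        using tree that unfolding a(4) tournament_def node_ok_def by auto
    qed
  next
    fix \<tau>2 i2 re2
    assume b: "\<tau>2 \<le> \<tau>1 + 25 * l + 10" "tournament (2 * r) (nodes base i2 re2)"
      "\<And>a. a < base \<Longrightarrow> a < 22 \<or> 26 < a \<Longrightarrow> i2 a = i1 a"
      "\<And>w. w < 2 * r \<Longrightarrow> nodes base i2 re2 (2 * r + w) = nodes base i1 re1 (2 * r + w)"
    have "frame i i2" using a(2) b(3) unfolding frame_def by auto
    then show "Q \<tau>2 i2 re2"
      by (intro Q layout_frame[OF lay]) (use a b w in auto)
  qed
qed

definition U :: nat where "U = 25 * l + 50"

definition leaves_ok :: "int \<Rightarrow> (nat \<Rightarrow> int) \<Rightarrow> nat \<Rightarrow> (nat \<Rightarrow> int) \<Rightarrow> (nat \<Rightarrow> real) \<Rightarrow> bool" where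
  "leaves_ok s hi v i re \<longleftrightarrow> (\<forall>w<v. nodes base i re (2 * r + w) = leaf s hi w)"

lemma frameD: "frame i i' \<Longrightarrow> a < 20 \<Longrightarrow> i' a = i a"
  unfolding frame_def base_def by auto

lemma layout_cong:
  assumes "layout hi i" "\<And>a. a < base \<Longrightarrow> a \<notin> {6, 7, 8, 10} \<Longrightarrow> a < 20 \<or> 32 < a \<Longrightarrow> i' a = i a"
  shows "layout hi i'"
  using assms unfolding layout_def desc_ok_def base_def by auto

lemma wp_refresh:
  assumes lay: "layout hi i" and s: "i 6 = s" and tree: "tournament (2 * r) (nodes base i re)"
    and Q: "\<And>\<tau>' i' re'. \<tau>' \<le> \<tau> + 2 * r * (U + 3) + 5 \<Longrightarrow> layout hi i' \<Longrightarrow> i' 6 = s \<Longrightarrow> i' 7 = i 7 \<Longrightarrow>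
      tournament (2 * r) (nodes base i' re') \<Longrightarrow> leaves_ok s hi (2 * r) i' re' \<Longrightarrow> Q \<tau>' i' re'"
  shows "wp A B refresh Q \<tau> i re"
proof -
  define T where "T = \<tau> + 2 * r * (U + 3) + 3"
  \<comment> \<open>An iteration costs one update, one instruction and two jumps, hence
    \<open>U + 3\<close>.\<close>
  define Inv where "Inv \<tau>' i' re' \<longleftrightarrow> (\<exists>w\<le>2 * r. i' 8 = int w \<and> \<tau>' + (2 * r - w) * (U + 3) \<le> T \<and> layout hi i' \<and>
      i' 6 = s \<and> i' 7 = i 7 \<and> tournament (2 * r) (nodes base i' re') \<and> leaves_ok s hi w i' re')"
    for \<tau>' :: nat and i' :: "nat \<Rightarrow> int" and re' :: "nat \<Rightarrow> real"
  show ?thesis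
    unfolding refresh_def
  proof (rule wp_Seq, rule wp_Blk, simp, simp, rule wp_Loop[where Inv = Inv and T = T])
    have "nodes base (i(8 := 0)) re = nodes base i re"
      unfolding nodes_def by (auto simp: base_neq)
    moreover have "layout hi (i(8 := 0))" by (rule layout_cong[OF lay]) auto
    ultimately show "Inv (Suc \<tau>) (i(8 := 0)) re"
      unfolding Inv_def using s tree
      by (intro exI[of _ 0]) (auto simp: T_def leaves_ok_def)
  next
    show "Inv \<tau>' i' re' \<Longrightarrow> \<tau>' \<le> T" for \<tau>' i' re'
      unfolding Inv_def by auto
  next
    fix \<tau>' i' re' assume I: "Inv \<tau>' i' re'" and h: "\<not> holds (LeI 8 9) i' re'"
    then obtain w where w: "w \<le> 2 * r" "i' 8 = int w" "layout hi i'" "\<tau>' \<le> T" "leaves_ok s hi w i' re'"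
       "i' 6 = s" "i' 7 = i 7" "tournament (2 * r) (nodes base i' re')"
      unfolding Inv_def by auto
    then have "w = 2 * r" using h layoutD(6)[OF w(3)] by simp
    then show "Q (\<tau>' + 2) i' re'" by (intro Q) (use w in \<open>auto simp: T_def\<close>)
  next
    fix \<tau>' i' re' assume I: "Inv \<tau>' i' re'" and h: "holds (LeI 8 9) i' re'"
    then obtain w where w: "w \<le> 2 * r" "i' 8 = int w" "layout hi i'" "\<tau>' + (2 * r - w) * (U + 3) \<le> T" "leaves_ok s hi w i' re'"
       "i' 6 = s" "i' 7 = i 7" "tournament (2 * r) (nodes base i' re')"
      unfolding Inv_def by auto
    have lt: "w < 2 * r" using w h layoutD(6)[OF w(3)] by simp
    then have d: "2 * r - w = Suc (2 * r - Suc w)" by simp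
    show "wp A B (update ;; Blk [IAdd 8 8 2]) (\<lambda>\<tau>. Inv (\<tau> + 1)) (\<tau>' + 1) i' re'"
    proof (rule wp_Seq, rule wp_update[OF w(3) w(6) w(2) lt w(8)], rule wp_Blk, simp)
      fix t i2 re2 assume a: "t \<le> \<tau>' + 1 + 25 * l + 50" "layout hi i2" "frame i' i2"
        "tournament (2 * r) (nodes base i2 re2)" "nodes base i2 re2 (2 * r + w) = leaf s hi w"
        "\<And>w'. w' < 2 * r \<Longrightarrow> w' \<noteq> w \<Longrightarrow> nodes base i2 re2 (2 * r + w') = nodes base i' re' (2 * r + w')"
      have c: "i2 2 = 1" "i2 6 = s" "i2 7 = i 7" "i2 8 = int w"
        using frameD[OF a(3)] layoutD[OF w(3)] w by auto
      have n: "nodes base (i2(8 := x)) re2 = nodes base i2 re2" for x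
        unfolding nodes_def by (auto simp: base_neq)
      have lay2: "layout hi (i2(8 := x))" for x by (rule layout_cong[OF a(2)]) auto
      have lv: "leaves_ok s hi (Suc w) (i2(8 := x)) re2" for x
        unfolding leaves_ok_def n using a(5,6) w(5) lt by (auto simp: leaves_ok_def less_Suc_eq)
      have time: "t + 1 + 1 + (2 * r - Suc w) * (U + 3) \<le> T"
        using a(1) w(4) unfolding d U_def by simp
      have "Inv (t + 1 + 1) (i2(8 := int w + 1)) re2"
        unfolding Inv_def
        using n lay2 lv c a(4) time lt by (intro exI[of _ "Suc w"]) auto
      then show "eff A B [IAdd 8 8 2] (\<lambda>\<tau>. Inv (\<tau> + 1)) t i2 re2"
        using c by simp
    qed
  qed
qed

text \<open>Each acceptance lowers the remainder by \<open>s\<close>, so the bound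
  \<open>4 * r * s\<close> pays for \<open>4 * r\<close> of them, each at most an update, seven
  instructions and two jumps.\<close>

lemma wp_accept:
  assumes lay: "layout hi i" and g: "good hi" and s: "i 6 = s" "1 \<le> s"
    and rem: "i 7 = int k - taken hi" "0 \<le> i 7" "i 7 \<le> 4 * int r * s"
    and tree: "tournament (2 * r) (nodes base i re)" and lv: "leaves_ok s hi (2 * r) i re"
    and Q: "\<And>\<tau>' i' re' hi'. \<tau>' \<le> \<tau> + 4 * r * (U + 9) + 8 \<Longrightarrow> layout hi' i' \<Longrightarrow> good hi' \<Longrightarrow>
      i' 6 = s \<Longrightarrow> i' 7 = int k - taken hi' \<Longrightarrow> 0 \<le> i' 7 \<Longrightarrow> i' 7 \<le> 2 * int r * (s - 1) \<Longrightarrow>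
      tournament (2 * r) (nodes base i' re') \<Longrightarrow> Q \<tau>' i' re'"
  shows "wp A B accept Q \<tau> i re"
proof -
  define T where "T = \<tau> + 4 * r * (U + 9) + 6"
  define lim where "lim = (s - 1) * (2 * int r) + 1"
  define Inv where "Inv \<tau>' i' re' \<longleftrightarrow> (\<exists>hi q. \<tau>' + q * (U + 9) \<le> T \<and> layout hi i' \<and> good hi \<and>
      i' 6 = s \<and> i' 7 = int k - taken hi \<and> 0 \<le> i' 7 \<and> i' 7 \<le> int q * s \<and> i' 10 = lim \<and>
      tournament (2 * r) (nodes base i' re') \<and> leaves_ok s hi (2 * r) i' re')"
    for \<tau>' :: nat and i' :: "nat \<Rightarrow> int" and re' :: "nat \<Rightarrow> real"
  note reg = layoutD(1-13)[OF lay]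
  show ?thesis
    unfolding accept_def
  proof (rule wp_Seq, rule wp_Blk, simp, simp add: reg s, rule wp_Loop[where Inv = Inv and T = T])
    have "nodes base (i(10 := lim)) re = nodes base i re"
      unfolding nodes_def by (auto simp: base_neq)
    moreover have "layout hi (i(10 := lim))" by (rule layout_cong[OF lay]) auto
    ultimately show "Inv (Suc (Suc (Suc \<tau>))) (i(10 := (s - 1) * (2 * int r) + 1)) re"
      unfolding Inv_def using s tree g rem lv
      by (intro exI[of _ hi] exI[of _ "4 * r"]) (auto simp: T_def leaves_ok_def lim_def)
  next
    show "Inv \<tau>' i' re' \<Longrightarrow> \<tau>' \<le> T" for \<tau>' i' re'
      unfolding Inv_def by auto
  next
    fix \<tau>' i' re' assume I: "Inv \<tau>' i' re'" and h: "\<not> holds (LeI 10 7) i' re'"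
    then obtain hi where "layout hi i'" "good hi" "i' 6 = s" "i' 7 = int k - taken hi" "0 \<le> i' 7" "i' 10 = lim"
        "tournament (2 * r) (nodes base i' re')" "\<tau>' \<le> T"
      unfolding Inv_def by auto
    then show "Q (\<tau>' + 2) i' re'"
      by (intro Q[of _ hi]) (use h in \<open>auto simp: T_def lim_def algebra_simps\<close>)
  next
    fix \<tau>' i' re' assume I: "Inv \<tau>' i' re'" and h: "holds (LeI 10 7) i' re'"
    then obtain hi q where lay: "layout hi i'" and g: "good hi" and t: "\<tau>' + q * (U + 9) \<le> T"
      and i: "i' 6 = s" "i' 7 = int k - taken hi" "0 \<le> i' 7" "i' 7 \<le> int q * s" "i' 10 = lim"
      and tree: "tournament (2 * r) (nodes base i' re')" and lv: "leaves_ok s hi (2 * r) i' re'"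
      unfolding Inv_def by auto
    have room: "int (2 * r) * (s - 1) < int k - taken hi" using h i by (simp add: lim_def mult.commute)
    let ?N = "nodes base i' re'"
    have lf: "?N (2 * r + w) = leaf s hi w" if "w < 2 * r" for w
      using lv that unfolding leaves_ok_def by auto
    obtain w0 where w0: "w0 < 2 * r" "hi w0 + s \<le> int n"
      using exists_long_list[OF g room card_entries] by auto
    obtain w where w: "w < 2 * r" "?N 1 = leaf s hi w"
      using tournament_leaf[OF tree, of 1] r_pos lf by force
    have root: "beats (leaf s hi w) (leaf s hi w')" if "w' < 2 * r" for w'
      using tournament_root_beats[OF tree, of "2 * r + w'"] that w(2) lf[OF that] by auto
    have live: "hi w + s \<le> int n"
    proof (rule ccontr)
      assume c: "\<not> hi w + s \<le> int n"
      have lo: "list_lo r w0 \<le> hi w0 + s" using g w0 s(2) unfolding good_def by force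
      have "A n + B n = Mval A B (int n, int n)" by (simp add: Mval_def)
      also have "\<dots> \<le> list_val A B r w0 (hi w0 + s)"
      proof -
        have "list_pos r w0 (hi w0 + s) \<in> grid n"
          by (rule list_pos_grid) (use lo w0 in \<open>auto simp: entries_def\<close>)
        then show ?thesis unfolding list_val_def
          by (cases "list_pos r w0 (hi w0 + s)") (auto intro!: Mval_mono simp: grid_def)
      qed
      finally show False
        using root[OF w0(1)] c w0 unfolding beats_def leaf_def by auto
    qed
    have best: "bef (w, hi w + s) (w', hi w' + s)" if "w' < 2 * r" "w' \<noteq> w" "hi w' + s \<le> int n" for w'
      using root[OF that(1)] that live unfolding beats_def leaf_def bef_def by auto
    define hi2 where "hi2 = hi(w := hi w + s)"
    have g2: "good hi2"
      unfolding hi2_def by (rule good_accept[OF g s(2) room w(1) live best])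
    have taken2: "taken hi2 = taken hi + s"
    proof -
      have "taken hi2 = (\<Sum>w'<2 * r. (hi w' - list_lo r w' + 1) + (if w' = w then s else 0))"
        unfolding taken_def hi2_def by (rule sum.cong) auto
      also have "\<dots> = taken hi + s" unfolding sum.distrib taken_def using w(1) by simp
      finally show ?thesis .
    qed
    \<comment> \<open>More than \<open>2 * r * (s - 1)\<close> entries remain, so at least
      \<open>s\<close> do, and accepting \<open>s\<close> of them cannot overshoot
      \<open>k\<close>.\<close>
    have rem2: "s \<le> i' 7"
    proof -
      have "1 * (s - 1) \<le> int (2 * r) * (s - 1)" by (rule mult_right_mono) (use r_pos s(2) in auto)
      then show ?thesis using room i(2) by simp
    qed
    obtain q' where q': "q = Suc q'" using i(4) rem2 s(2) by (cases q) auto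
    have rw: "i' (Suc base) = int w"
      using w live unfolding nodes_def leaf_def by simp
    have ad: "nat (1 + int base) = Suc base" "nat (int w * 4 + 36) = 36 + 4 * w" "nat (int base + 1) = Suc base" by auto
    note reg = layoutD(1-13)[OF lay] layoutD(16)[OF lay w(1)]
    define i2 where "i2 = i'(8 := int w, 20 := int w * 4 + 36, 21 := hi w + s, 36 + 4 * w := hi w + s, 7 := int k - taken hi - s)"
    have sub: "36 + 4 * w < base" using w(1) unfolding base_def by simp
    have lay2: "layout hi2 i2"
      using lay sub unfolding layout_def desc_ok_def i2_def hi2_def by (auto simp: base_neq)
    have n2: "nodes base i2 re' = ?N"
      unfolding nodes_def i2_def using sub by (auto simp: base_neq)
    show "wp A B (Blk [ILoad 8 16, IMul 20 8 11, IAdd 20 20 15, ILoad 21 20, IAdd 21 21 6, IStore 20 21, ISub 7 7 6] ;;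
        update) (\<lambda>\<tau>. Inv (\<tau> + 1)) (\<tau>' + 1) i' re'"
    proof (rule wp_Seq, rule wp_Blk, simp, simp add: reg i ad rw, fold i2_def)
      show "wp A B update (\<lambda>\<tau>. Inv (Suc \<tau>)) (Suc (Suc (Suc (Suc (Suc (Suc (Suc (Suc \<tau>')))))))) i2 re'"
    proof (rule wp_update[OF lay2 _ _ w(1)])
      show "i2 6 = s" "i2 8 = int w" "tournament (2 * r) (nodes base i2 re')"
        using i tree n2 unfolding i2_def by auto
      fix t i3 re3 assume a: "t \<le> Suc (Suc (Suc (Suc (Suc (Suc (Suc (Suc \<tau>'))))))) + 25 * l + 50"
        "layout hi2 i3" "frame i2 i3" "tournament (2 * r) (nodes base i3 re3)"
        "nodes base i3 re3 (2 * r + w) = leaf s hi2 w"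
        "\<And>w'. w' < 2 * r \<Longrightarrow> w' \<noteq> w \<Longrightarrow> nodes base i3 re3 (2 * r + w') = nodes base i2 re' (2 * r + w')"
      have "i3 6 = s" "i3 7 = int k - taken hi2" "i3 10 = lim"
        using frameD[OF a(3)] i taken2 unfolding i2_def by auto
      moreover have "leaves_ok s hi2 (2 * r) i3 re3"
        unfolding leaves_ok_def
      proof (intro allI impI)
        fix w' assume w': "w' < 2 * r"
        show "nodes base i3 re3 (2 * r + w') = leaf s hi2 w'"
          using a(5) a(6)[OF w'] n2 lf[OF w'] by (cases "w' = w") (auto simp: leaf_def hi2_def)
      qed
      moreover have "Suc t + q' * (U + 9) \<le> T"
        using t a(1) unfolding q' U_def by simp
      moreover have "int k - taken hi2 \<le> int q' * s"
        using i(2,4) taken2 unfolding q' by (simp add: algebra_simps)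
      moreover have "0 \<le> int k - taken hi2" using rem2 i(2) taken2 by simp
      ultimately show "Inv (Suc t) i3 re3"
        unfolding Inv_def using a(2,4) g2 by (intro exI[of _ hi2] exI[of _ q']) auto
      qed
    qed
  qed
qed

end

section \<open>Initialisation and assembly of the selection program\<close>

definition find_side :: com where
  "find_side = Blk [IConst 2 1, IConst 11 4, IConst 12 2, IConst 14 33, IConst 15 36, IConst 17 8, IConst 20 1] ;;
     Loop (LeI 20 1) (Blk [IAdd 3 3 2, IMul 20 3 3, IAdd 20 20 2])"

text \<open>Cells 20 and 21 are write pointers for row and column descriptors, one of each per
  iteration. The kind cell of a row is skipped, as it is still zero.\<close>

definition make_lists :: com where
  "make_lists = Blk [IMul 4 3 12, IMul 5 4 11, IAdd 5 5 14, ISub 9 4 2, IAdd 16 5 2, IAdd 6 1 13, IAdd 7 1 13,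
       IAdd 8 2 13, IAdd 20 14 13, IMul 21 3 11, IAdd 21 21 20, IAdd 22 3 2] ;;
     Loop (LeI 8 3) (Blk [IAdd 20 20 2, IStore 20 8, IAdd 20 20 2, IStore 20 2, IAdd 20 20 2, IStore 20 13,
       IAdd 20 20 2, IStore 21 2, IAdd 21 21 2, IStore 21 8, IAdd 21 21 2, IStore 21 22, IAdd 21 21 2,
       IStore 21 3, IAdd 21 21 2, IAdd 8 8 2])"

text \<open>The registers overlap the first eight descriptors, which become empty ranges.\<close>

definition finish :: com where
  "finish = Blk [IAdd 0 4 17, IConst 3 1, IConst 4 0, IConst 7 1, IConst 8 0, IConst 11 1, IConst 12 0,
     IConst 15 1, IConst 16 0, IConst 19 1, IConst 20 0, IConst 23 1, IConst 24 0, IConst 27 1, IConst 28 0,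
     IConst 31 1, IConst 32 0]"

definition select :: com where
  "select = find_side ;; make_lists ;; phases ;; finish"

text \<open>Linear search is affordable because \<open>r\<close> is itself of order
  \<open>sqrt k\<close>. The last successful test survives as \<open>(r - 1) * (r - 1) < k\<close>,
  the source of all upper bounds on \<open>r\<close>.\<close>

lemma wp_find_side:
  assumes i: "i 1 = int k" "i 3 = 0" and k: "1 \<le> k"
    and Q: "\<And>\<tau>' r x. \<tau>' \<le> \<tau> + 5 * r + 10 \<Longrightarrow> 1 \<le> r \<Longrightarrow> (r - 1) * (r - 1) < k \<Longrightarrow> k \<le> r * r \<Longrightarrow>
      Q \<tau>' (i(2 := 1, 11 := 4, 12 := 2, 14 := 33, 15 := 36, 17 := 8, 3 := int r, 20 := x)) re"
  shows "wp A B find_side Q \<tau> i re"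
proof -
  let ?i = "\<lambda>q. i(2 := 1, 11 := 4, 12 := 2, 14 := 33, 15 := 36, 17 := 8, 3 := int q, 20 := int (q * q) + 1)"
  define T where "T = \<tau> + 5 * k + 7"
  define Inv where "Inv \<tau>' i' re' \<longleftrightarrow> (\<exists>q. i' = ?i q \<and> re' = re \<and> \<tau>' \<le> \<tau> + 5 * q + 7 \<and> q \<le> k \<and>
      (q = 0 \<or> (q - 1) * (q - 1) < k))" for \<tau>' :: nat and i' :: "nat \<Rightarrow> int" and re' :: "nat \<Rightarrow> real"
  show ?thesis
    unfolding find_side_def
  proof (rule wp_Seq, rule wp_Blk, simp, simp, rule wp_Loop[where Inv = Inv and T = T])
    show "Inv (Suc (Suc (Suc (Suc (Suc (Suc (Suc \<tau>)))))))
       (i(2 := 1, 11 := 4, 12 := 2, 14 := 33, 15 := 36, 17 := 8, 20 := 1)) re"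
      unfolding Inv_def using i by (intro exI[of _ 0]) (auto simp: fun_eq_iff)
  next
    show "Inv \<tau>' i' re' \<Longrightarrow> \<tau>' \<le> T" for \<tau>' i' re'
      unfolding Inv_def T_def by auto
  next
    fix \<tau>' i' re' assume I: "Inv \<tau>' i' re'" and h: "\<not> holds (LeI 20 (Suc 0)) i' re'"
    then obtain q where q: "i' = ?i q" "re' = re" "\<tau>' \<le> \<tau> + 5 * q + 7" "q = 0 \<or> (q - 1) * (q - 1) < k"
      unfolding Inv_def by auto
    have "int k < int (q * q) + 1" using h i unfolding q by simp
    then have kq: "k \<le> q * q" by linarith
    then have "1 \<le> q" using k by (cases q) auto
    then show "Q (\<tau>' + 2) i' re'" unfolding q by (intro Q) (use q kq in auto)
  next
    fix \<tau>' i' re' assume I: "Inv \<tau>' i' re'" and h: "holds (LeI 20 (Suc 0)) i' re'"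
    then obtain q where q: "i' = ?i q" "re' = re" "\<tau>' \<le> \<tau> + 5 * q + 7"
      unfolding Inv_def by auto
    have "int (q * q) + 1 \<le> int k" using h i unfolding q by simp
    then have kq: "q * q < k" by linarith
    moreover have "q \<le> q * q" by simp
    ultimately have "Suc q \<le> k" by linarith
    then have "Inv (\<tau>' + 5) (?i (Suc q)) re"
      unfolding Inv_def using q kq by (intro exI[of _ "Suc q"]) auto
    moreover have "?i (Suc q) = (?i q)(3 := int q + 1, 20 := (int q + 1) * (int q + 1) + 1)"
      by (auto simp: fun_eq_iff algebra_simps)
    ultimately show "wp A B (Blk [IAdd 3 3 2, IMul 20 3 3, IAdd 20 20 2]) (\<lambda>\<tau>. Inv (\<tau> + 1)) (\<tau>' + 1) i' re'"
      unfolding q(1,2) by (intro wp_Blk) (simp_all add: numeral_eq_Suc del: of_nat_Suc)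
  qed
qed

context selection
begin

definition phase_time :: nat where
  "phase_time = 2 * r * (U + 3) + 4 * r * (U + 9) + 20"

text \<open>The number \<open>p\<close> of phases still allowed bounds the binary length of the
  width. At width 0 the invariant \<open>i 7 \<le> 4 * int r * i 6\<close> leaves nothing to accept,
  so exactly \<open>k\<close> entries are taken on exit.\<close>

lemma wp_phases:
  assumes "layout hi i" "good hi" "i 7 = int k - taken hi" "0 \<le> i 7" "i 7 \<le> 4 * int r * i 6"
    "0 \<le> i 6" "i 6 < 2 ^ p" "tournament (2 * r) (nodes base i re)"
    and Q: "\<And>\<tau>' i' re' hi'. \<tau>' \<le> \<tau> + p * phase_time + 2 \<Longrightarrow> layout hi' i' \<Longrightarrow> good hi' \<Longrightarrow>
      taken hi' = int k \<Longrightarrow> Q \<tau>' i' re'"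
  shows "wp A B phases Q \<tau> i re"
proof -
  define T where "T = \<tau> + p * phase_time"
  define Inv where "Inv \<tau>' i' re' \<longleftrightarrow> (\<exists>hi p. \<tau>' + p * phase_time \<le> T \<and> layout hi i' \<and> good hi \<and>
      i' 7 = int k - taken hi \<and> 0 \<le> i' 7 \<and> i' 7 \<le> 4 * int r * i' 6 \<and> 0 \<le> i' 6 \<and> i' 6 < 2 ^ p \<and>
      tournament (2 * r) (nodes base i' re'))"
    for \<tau>' :: nat and i' :: "nat \<Rightarrow> int" and re' :: "nat \<Rightarrow> real"
  show ?thesis
    unfolding phases_def
  proof (rule wp_Loop[where Inv = Inv and T = T])
    show "Inv \<tau> i re"
      unfolding Inv_def using assms(1-8) by (intro exI[of _ hi] exI[of _ p]) (auto simp: T_def)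
  next
    show "Inv \<tau>' i' re' \<Longrightarrow> \<tau>' \<le> T" for \<tau>' i' re'
      unfolding Inv_def by auto
  next
    fix \<tau>' i' re' assume I: "Inv \<tau>' i' re'" and h: "\<not> holds (LeI 2 6) i' re'"
    then obtain hi where a: "layout hi i'" "good hi" "i' 7 = int k - taken hi" "0 \<le> i' 7"
        "i' 7 \<le> 4 * int r * i' 6" "0 \<le> i' 6" "\<tau>' \<le> T"
      unfolding Inv_def by auto
    then have "i' 6 = 0" using h layoutD(3)[OF a(1)] by simp
    then show "Q (\<tau>' + 2) i' re'" by (intro Q[of _ hi]) (use a in \<open>auto simp: T_def\<close>)
  next
    fix \<tau>' i' re' assume I: "Inv \<tau>' i' re'" and h: "holds (LeI 2 6) i' re'"
    then obtain hi p where a: "\<tau>' + p * phase_time \<le> T" "layout hi i'" "good hi" "i' 7 = int k - taken hi" "0 \<le> i' 7"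
        "i' 7 \<le> 4 * int r * i' 6" "0 \<le> i' 6" "i' 6 < 2 ^ p" "tournament (2 * r) (nodes base i' re')"
      unfolding Inv_def by blast
    have s1: "1 \<le> i' 6" using h layoutD(3)[OF a(2)] by simp
    then obtain p' where p': "p = Suc p'" using a(8) by (cases p) auto
    show "wp A B (refresh ;; accept ;; Blk [IDiv 6 6 12]) (\<lambda>\<tau>. Inv (\<tau> + 1)) (\<tau>' + 1) i' re'"
    proof (rule wp_Seq, rule wp_refresh[OF a(2) refl a(9)])
      fix t1 i1 re1
      assume b: "t1 \<le> \<tau>' + 1 + 2 * r * (U + 3) + 5" "layout hi i1" "i1 6 = i' 6" "i1 7 = i' 7"
        "tournament (2 * r) (nodes base i1 re1)" "leaves_ok (i' 6) hi (2 * r) i1 re1"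
      show "wp A B (accept ;; Blk [IDiv 6 6 12]) (\<lambda>\<tau>. Inv (\<tau> + 1)) t1 i1 re1"
      proof (rule wp_Seq, rule wp_accept[OF b(2) a(3) b(3) s1 _ _ _ b(5,6)])
        show "i1 7 = int k - taken hi" "0 \<le> i1 7" "i1 7 \<le> 4 * int r * i' 6" using a b by auto
      next
        fix t2 i2 re2 hi2
        assume c: "t2 \<le> t1 + 4 * r * (U + 9) + 8" "layout hi2 i2" "good hi2" "i2 6 = i' 6"
          "i2 7 = int k - taken hi2" "0 \<le> i2 7" "i2 7 \<le> 2 * int r * (i' 6 - 1)"
          "tournament (2 * r) (nodes base i2 re2)"
        define s where "s = i' 6 div 2"
        \<comment> \<open>Integer halving loses at most 1, which the \<open>- 1\<close> in the exit
          bound of \<open>accept\<close> absorbs.\<close>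
        have "2 * int r * (i' 6 - 1) \<le> 2 * int r * (2 * s)"
          by (rule mult_left_mono) (auto simp: s_def)
        then have s: "i2 7 \<le> 4 * int r * s" "0 \<le> s" "s < 2 ^ p'"
          using c(7) s1 a(8) p' unfolding s_def by auto
        have n: "nodes base (i2(6 := s)) re2 = nodes base i2 re2"
          unfolding nodes_def by (auto simp: base_neq)
        have lay: "layout hi2 (i2(6 := s))" by (rule layout_cong[OF c(2)]) auto
        have time: "Suc (Suc t2) + p' * phase_time \<le> T"
          using a(1) b(1) c(1) unfolding p' phase_time_def by simp
        have "Inv (Suc (Suc t2)) (i2(6 := s)) re2"
          unfolding Inv_def
          by (rule exI[of _ hi2], rule exI[of _ p']) (use n lay time c s in auto)
        then show "wp A B (Blk [IDiv 6 6 12]) (\<lambda>\<tau>. Inv (\<tau> + 1)) t2 i2 re2"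
          using c(4) layoutD(8)[OF c(2)] by (intro wp_Blk) (simp_all add: s_def)
      qed
    qed
  qed
qed

definition start :: "nat \<Rightarrow> int" where
  "start w = list_lo r w - 1"

lemma good_start: "good start" "taken start = 0"
  using r by (auto simp: good_def accepted_def start_def taken_def list_lo_def)

lemma desc_ok_cong:
  assumes "desc_ok hi i w" "w < 2 * r" "\<And>a. 33 \<le> a \<Longrightarrow> a < base \<Longrightarrow> i' a = i a"
  shows "desc_ok hi i' w"
  using assms unfolding desc_ok_def base_def by auto

lemma wp_make_lists:
  assumes i: "i 0 = int n" "i 1 = int k" "i 2 = 1" "i 3 = int r" "i 11 = 4" "i 12 = 2" "i 13 = 0" "i 14 = 33"
      "i 15 = 36" "i 17 = 8"
    and zero: "\<And>a. 33 \<le> a \<Longrightarrow> i a = 0"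
    and Q: "\<And>\<tau>' i'. \<tau>' \<le> \<tau> + 20 * r + 20 \<Longrightarrow> layout start i' \<Longrightarrow> i' 6 = int k \<Longrightarrow> i' 7 = int k \<Longrightarrow>
      (\<And>a. base \<le> a \<Longrightarrow> i' a = 0) \<Longrightarrow> Q \<tau>' i' re"
  shows "wp A B make_lists Q \<tau> i re"
proof -
  define i0 where "i0 = i(4 := int r * 2, 5 := 33 + int r * 8, 9 := int r * 2 - 1, 16 := int r * 8 + 34,
    6 := int k, 7 := int k)"
  define T where "T = \<tau> + 20 * r + 18"
  define Inv where "Inv \<tau>' i' re' \<longleftrightarrow> (\<exists>j\<le>r. \<tau>' + (r - j) * 20 \<le> T \<and> re' = re \<and> i' 8 = int j + 1 \<and>
      i' 20 = 33 + 4 * int j \<and> i' 21 = 33 + (4 * int r + 4 * int j) \<and> i' 22 = int r + 1 \<and>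
      (\<forall>a<20. a \<noteq> 8 \<longrightarrow> i' a = i0 a) \<and> (\<forall>w<r. i' (33 + 4 * w) = 0) \<and> (\<forall>a\<ge>base. i' a = 0) \<and>
      (\<forall>w<j. desc_ok start i' w \<and> desc_ok start i' (r + w)))"
    for \<tau>' :: nat and i' :: "nat \<Rightarrow> int" and re' :: "nat \<Rightarrow> real"
  show ?thesis
    unfolding make_lists_def
  proof (rule wp_Seq, rule wp_Blk, simp, simp add: i[simplified], rule wp_Loop[where Inv = Inv and T = T])
    show "Inv (Suc (Suc (Suc (Suc (Suc (Suc (Suc (Suc (Suc (Suc (Suc (Suc \<tau>))))))))))))
      (i(4 := int r * 2, 5 := 8 * int r + 33, 9 := int r * 2 - 1,
           16 := 34 + 8 * int r, 6 := int k, 7 := int k, 8 := 1, 20 := 33,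
           21 := int r * 4 + 33, 22 := int r + 1)) re"
      unfolding Inv_def using zero
      by (intro exI[of _ 0]) (auto simp: T_def i0_def base_def)
  next
    show "Inv \<tau>' i' re' \<Longrightarrow> \<tau>' \<le> T" for \<tau>' i' re'
      unfolding Inv_def by auto
  next
    fix \<tau>' i' re' assume I: "Inv \<tau>' i' re'" and h: "\<not> holds (LeI 8 3) i' re'"
    then obtain j where j: "j \<le> r" "\<tau>' \<le> T" "re' = re" "i' 8 = int j + 1"
      and low: "\<And>a. a < 20 \<Longrightarrow> a \<noteq> 8 \<Longrightarrow> i' a = i0 a" and z: "\<forall>a\<ge>base. i' a = 0"
      and d: "\<forall>w<j. desc_ok start i' w \<and> desc_ok start i' (r + w)"
      unfolding Inv_def by auto
    have "i' 3 = int r" using low i by (simp add: i0_def)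
    then have jr: "j = r" using h j by simp
    have desc: "desc_ok start i' w" if "w < 2 * r" for w
    proof (cases "w < r")
      case False
      then have "r + (w - r) = w" "w - r < j" using that jr by auto
      then show ?thesis using d by metis
    qed (use d jr in auto)
    have "layout start i'"
      unfolding layout_def using low desc by (auto simp: i0_def i[simplified] base_def)
    then show "Q (\<tau>' + 2) i' re'"
      unfolding j(3) by (intro Q) (use low z j(2) in \<open>auto simp: i0_def T_def\<close>)
  next
    fix \<tau>' i' re' assume I: "Inv \<tau>' i' re'" and h: "holds (LeI 8 3) i' re'"
    then obtain j where j: "j \<le> r" "\<tau>' + (r - j) * 20 \<le> T" "re' = re" "i' 8 = int j + 1"
        "i' 20 = 33 + 4 * int j" "i' 21 = 33 + (4 * int r + 4 * int j)" "i' 22 = int r + 1"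
      and low: "\<And>a. a < 20 \<Longrightarrow> a \<noteq> 8 \<Longrightarrow> i' a = i0 a" and z: "\<And>a. base \<le> a \<Longrightarrow> i' a = 0"
      and rz: "\<And>w. w < r \<Longrightarrow> i' (33 + 4 * w) = 0"
      and d: "\<And>w. w < j \<Longrightarrow> desc_ok start i' w" "\<And>w. w < j \<Longrightarrow> desc_ok start i' (r + w)"
      unfolding Inv_def by auto
    have c: "i' 3 = int r" "i' 13 = 0" "i' 2 = 1" using low i by (simp_all add: i0_def)
    have jr: "j < r" using h j c by simp
    define i2 where "i2 = i'(34 + 4 * j := int j + 1, 35 + 4 * j := 1, 36 + 4 * j := 0,
           20 := 37 + 4 * int j, 33 + (4 * r + 4 * j) := 1,
           34 + (4 * r + 4 * j) := int j + 1,
           35 + (4 * r + 4 * j) := int r + 1,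
           36 + (4 * r + 4 * j) := int r,
           21 := 37 + (4 * int r + 4 * int j), 8 := 2 + int j)"
    \<comment> \<open>Residues modulo 4 separate the kind cells of rows from the other descriptor
      cells.\<close>
    have m4: "Suc (4 * a) \<noteq> 4 * b" "2 + 4 * a \<noteq> 4 * b" "3 + 4 * a \<noteq> 4 * b" for a b :: nat
      by presburger+
    have same: "i2 a = i' a" if "33 \<le> a" "a < 33 + 4 * j \<or> 37 + 4 * j \<le> a" "a < 33 + 4 * r + 4 * j \<or> 37 + 4 * r + 4 * j \<le> a" for a
      using that unfolding i2_def by auto
    have new: "desc_ok start i2 w" if "w < Suc j" for w
    proof (cases "w = j")
      case True
      have "i2 (33 + 4 * j) = 0" unfolding i2_def using rz[OF jr] jr m4 by auto
      then show ?thesis using True jr by (auto simp: desc_ok_def start_def list_lo_def i2_def)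
    next
      case False
      then have "w < j" using that by simp
      then show ?thesis using d(1)[of w] jr same unfolding desc_ok_def by auto
    qed
    have new2: "desc_ok start i2 (r + w)" if "w < Suc j" for w
    proof (cases "w = j")
      case True
      have x: "33 + 4 * (r + j) = 33 + (4 * r + 4 * j)" "34 + 4 * (r + j) = 34 + (4 * r + 4 * j)"
        "35 + 4 * (r + j) = 35 + (4 * r + 4 * j)" "36 + 4 * (r + j) = 36 + (4 * r + 4 * j)" by auto
      show ?thesis unfolding True desc_ok_def x by (simp add: start_def list_lo_def i2_def)
    next
      case False
      then have "w < j" using that by simp
      then show ?thesis using d(2)[of w] jr same unfolding desc_ok_def by auto
    qed
    have rz2: "i2 (33 + 4 * w) = 0" if "w < r" for w
    proof (cases "w = j")
      case True
      then show ?thesis unfolding i2_def using rz[OF jr] jr m4 by auto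
    next
      case False
      then show ?thesis using rz[OF that] same[of "33 + 4 * w"] that by (cases "w < j") auto
    qed
    have z2: "i2 a = 0" if "base \<le> a" for a
      using z[OF that] same[of a] that jr unfolding base_def by auto
    have low2: "i2 a = i0 a" if "a < 20" "a \<noteq> 8" for a
      using low[OF that] that unfolding i2_def by auto
    have "\<tau>' + 18 + (r - Suc j) * 20 \<le> T"
    proof -
      have "r - j = Suc (r - Suc j)" using jr by simp
      then show ?thesis using j(2) by simp
    qed
    moreover have "i2 8 = int (Suc j) + 1" "i2 20 = 33 + 4 * int (Suc j)"
      "i2 21 = 33 + (4 * int r + 4 * int (Suc j))" "i2 22 = int r + 1"
      unfolding i2_def using j(7) by auto
    ultimately have "Inv (\<tau>' + 18) i2 re"
      unfolding Inv_def using jr new new2 rz2 z2 low2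
      by (intro exI[of _ "Suc j"]) auto
    then have "Inv (Suc (Suc (Suc (Suc (Suc (Suc (Suc (Suc (Suc (Suc (Suc (Suc (Suc (Suc (Suc (Suc (Suc (Suc \<tau>')))))))))))))))))) i2 re"
      by (simp add: numeral_eq_Suc)
    then show "wp A B (Blk [IAdd 20 20 2, IStore 20 8, IAdd 20 20 2, IStore 20 2, IAdd 20 20 2, IStore 20 13,
       IAdd 20 20 2, IStore 21 2, IAdd 21 21 2, IStore 21 8, IAdd 21 21 2, IStore 21 22, IAdd 21 21 2,
       IStore 21 3, IAdd 21 21 2, IAdd 8 8 2]) (\<lambda>\<tau>. Inv (\<tau> + 1)) (\<tau>' + 1) i' re'"
      unfolding j(3)
      by (intro wp_Blk) (simp, simp add: j c nat_add_distrib nat_mult_distrib i2_def)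
  qed
qed

text \<open>Cell 1 keeps \<open>k\<close> for the reporting program. It is the kind cell of
  descriptor 0, whose range is empty for either kind.\<close>

definition final_state :: "(nat \<Rightarrow> int) \<Rightarrow> (nat \<Rightarrow> int) \<Rightarrow> bool" where
  "final_state hi i \<longleftrightarrow> good hi \<and> taken hi = int k \<and> i 0 = 2 * int r + 8 \<and> i 1 = int k \<and>
     (\<forall>w<2 * r. desc_ok hi i w) \<and> (\<forall>t<8. i (4 * t + 3) = 1 \<and> i (4 * t + 4) = 0)"

lemma wp_finish:
  assumes lay: "layout hi i" and g: "good hi" "taken hi = int k"
    and Q: "\<And>\<tau>' i'. \<tau>' \<le> \<tau> + 17 \<Longrightarrow> final_state hi i' \<Longrightarrow> Q \<tau>' i' re"
  shows "wp A B finish Q \<tau> i re"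
proof -
  note reg = layoutD(1-13)[OF lay]
  define i' where "i' = i(0 := 2 * int r + 8, 3 := 1, 4 := 0, 7 := 1, 8 := 0, 11 := 1, 12 := 0, 15 := 1, 16 := 0,
     19 := 1, 20 := 0, 23 := 1, 24 := 0, 27 := 1, 28 := 0, 31 := 1, 32 := 0)"
  have "\<forall>w<2 * r. desc_ok hi i' w"
  proof (intro allI impI)
    fix w assume w: "w < 2 * r"
    then have "desc_ok hi i w" using lay unfolding layout_def by auto
    then show "desc_ok hi i' w" by (rule desc_ok_cong[OF _ w]) (auto simp: i'_def)
  qed
  moreover have "i' (4 * t + 3) = 1 \<and> i' (4 * t + 4) = 0" if "t < 8" for t
  proof -
    have "t = 0 \<or> t = 1 \<or> t = 2 \<or> t = 3 \<or> t = 4 \<or> t = 5 \<or> t = 6 \<or> t = 7" using that by linarith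
    then show ?thesis unfolding i'_def by (elim disjE) simp_all
  qed
  ultimately have out: "final_state hi i'"
    unfolding final_state_def using g by (auto simp: i'_def reg)
  show ?thesis
    unfolding finish_def
    by (rule wp_Blk, simp, simp add: reg, fold i'_def) (intro Q out, simp)
qed

lemma wp_select_lists:
  assumes i: "i 0 = int n" "i 1 = int k" "i 2 = 1" "i 3 = int r" "i 11 = 4" "i 12 = 2" "i 13 = 0" "i 14 = 33"
      "i 15 = 36" "i 17 = 8"
    and zero: "\<And>a. 33 \<le> a \<Longrightarrow> i a = 0" "\<And>a. re a = 0"
    and kl: "k < 2 ^ l"
    and Q: "\<And>\<tau>' i' re' hi. \<tau>' \<le> \<tau> + 20 * r + 40 + l * phase_time \<Longrightarrow> final_state hi i' \<Longrightarrow> Q \<tau>' i' re'"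
  shows "wp A B (make_lists ;; phases ;; finish) Q \<tau> i re"
proof (rule wp_Seq, rule wp_make_lists[OF i zero(1)])
  fix t1 i1
  assume a: "t1 \<le> \<tau> + 20 * r + 20" "layout start i1" "i1 6 = int k" "i1 7 = int k" "\<And>a. base \<le> a \<Longrightarrow> i1 a = 0"
  show "wp A B (phases ;; finish) Q t1 i1 re"
  proof (rule wp_Seq, rule wp_phases[OF a(2) good_start(1)])
    show "i1 7 = int k - taken start" "0 \<le> i1 7" "0 \<le> i1 6"
      using a good_start(2) by auto
    show "i1 6 < 2 ^ l" using kl a(3) by (metis of_nat_less_iff of_nat_numeral of_nat_power)
    have "1 * int k \<le> 4 * int r * int k" by (rule mult_right_mono) (use r_pos in auto)
    then show "i1 7 \<le> 4 * int r * i1 6" using a by simp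
    show "tournament (2 * r) (nodes base i1 re)"
      unfolding tournament_def node_ok_def nodes_def winner_def using a(5) zero(2) by simp
  next
    fix t2 i2 re2 hi
    assume b: "t2 \<le> t1 + l * phase_time + 2" "layout hi i2" "good hi" "taken hi = int k"
    show "wp A B finish Q t2 i2 re2"
      by (rule wp_finish[OF b(2-4)], rule Q) (use a(1) b(1) in auto)
  qed
qed auto

lemma decode_final_state:
  assumes "final_state hi (im s)"
  shows "decode s = selected hi"
proof -
  define D where "D t = (let kd = im s (4*t+1); a = im s (4*t+2); lo = im s (4*t+3); hi = im s (4*t+4) in
       if kd = 0 then {(a, j) | j. lo \<le> j \<and> j \<le> hi} else {(i, a) | i. lo \<le> i \<and> i \<le> hi})" for t
  have n: "num_desc s = 2 * r + 8" using assms unfolding num_desc_def final_state_def by auto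
  have D0: "D t = {}" if "t < 8" for t
    using assms that unfolding final_state_def D_def by (auto simp: Let_def)
  have D1: "D (w + 8) = list_pos r w ` {list_lo r w..hi w}" if "w < 2 * r" for w
  proof -
    have x: "4 * (w + 8) + 1 = 33 + 4 * w" "4 * (w + 8) + 2 = 34 + 4 * w" "4 * (w + 8) + 3 = 35 + 4 * w"
      "4 * (w + 8) + 4 = 36 + 4 * w" by auto
    have "desc_ok hi (im s) w" using assms that unfolding final_state_def by auto
    then show ?thesis
      unfolding D_def x Let_def desc_ok_def by (auto simp: list_pos_def)
  qed
  have "decode s = (\<Union>t<2 * r + 8. D t)"
    unfolding decode_def n D_def ..
  also have "\<dots> = (\<Union>w<2 * r. D (w + 8))"
  proof (intro equalityI subsetI)
    fix x assume "x \<in> (\<Union>t<2 * r + 8. D t)"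
    then obtain t where t: "t < 2 * r + 8" "x \<in> D t" by auto
    then have "8 \<le> t" using D0[of t] by (cases "t < 8") auto
    then show "x \<in> (\<Union>w<2 * r. D (w + 8))" using t by (intro UN_I[of "t - 8"]) auto
  qed auto
  also have "\<dots> = selected hi"
    unfolding selected_def accepted_def using D1 by force
  finally show ?thesis .
qed

end

lemma wp_select:
  assumes A: "sorted_noninc A n" and B: "sorted_noninc B n" and k: "1 \<le> k" "k \<le> n ^ 2" and l: "4 * k \<le> 2 ^ l"
    and Q: "\<And>\<tau>' i' re' r hi. selection A B n k r l \<Longrightarrow> (r - 1) * (r - 1) < k \<Longrightarrow>
      \<tau>' \<le> 25 * r + 50 + l * selection.phase_time r l \<Longrightarrow> selection.final_state A B n k r hi i' \<Longrightarrow> Q \<tau>' i' re'"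
  shows "wp A B select Q 0 (im (init n k)) (rm (init n k))"
  unfolding select_def
proof (rule wp_Seq, rule wp_find_side[of _ k])
  show "im (init n k) 1 = int k" "im (init n k) 3 = 0" by (simp_all add: init_def)
next
  fix t r x
  assume a: "t \<le> 0 + 5 * r + 10" "1 \<le> r" "(r - 1) * (r - 1) < k" "k \<le> r * r"
  \<comment> \<open>If \<open>r\<close> exceeded \<open>n\<close>, then
    \<open>n * n \<le> (r - 1) * (r - 1) < k\<close>, against \<open>k \<le> n ^ 2\<close>.\<close>
  have "r - 1 < n"
  proof (rule ccontr)
    assume "\<not> r - 1 < n"
    then have "n * n \<le> (r - 1) * (r - 1)" by (intro mult_le_mono) auto
    then show False using a(3) k(2) by (simp add: power2_eq_square)
  qed
  \<comment> \<open>With \<open>r \<le> k\<close>, the single exponent \<open>l\<close> bounds both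
    the tree height and the number of phases.\<close>
  have "r - 1 < k"
    using a(3) by (cases "r - 1 = 0") (auto intro: le_less_trans[of _ "(r - 1) * (r - 1)"])
  have kl: "k < 2 ^ l" using l k(1) by linarith
  interpret selection A B n k r l
    by unfold_locales (use A B a l \<open>r - 1 < n\<close> \<open>r - 1 < k\<close> in auto)
  show "wp A B (make_lists ;; phases ;; finish) Q t
     ((im (init n k))(2 := 1, 11 := 4, 12 := 2, 14 := 33, 15 := 36, 17 := 8, 3 := int r, 20 := x)) (rm (init n k))"
  proof (rule wp_select_lists)
    show "t' \<le> t + 20 * r + 40 + l * phase_time \<Longrightarrow> final_state hi i' \<Longrightarrow> Q t' i' re'" for t' i' re' hi
      using a by (intro Q[of r _ hi]) (auto intro: selection_axioms)
  qed (auto simp: init_def kl)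
qed (use k in auto)

section \<open>The reporting program\<close>

text \<open>Cells 9 and 10 are the write pointers for the pairs and the sums. Kind 0, a row, is
  recognised by comparison with the zero in cell 11.\<close>

definition emit_list :: com where
  "emit_list = Loop (LeI 14 15)
     (Choose (LeI 12 11) (Blk [IAdd 16 13 11, IAdd 17 14 11]) (Blk [IAdd 16 14 11, IAdd 17 13 11]) ;;
      Blk [RReadA 2 16, RReadB 3 17, RAdd 2 2 3, RStore 10 2, IStore 9 16, IAdd 9 9 2, IStore 9 17, IAdd 9 9 2,
        IAdd 10 10 2, IAdd 14 14 2])"

text \<open>The output area starts at \<open>4 * (2 * r + 8) + 2 * k + 40\<close>, beyond the
  descriptors still to be read and beyond the final cells up to \<open>2 * k\<close>. Reading starts
  at cell 33, past the eight empty descriptors.\<close>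

definition emit :: com where
  "emit = Blk [IConst 2 1, IConst 3 2, IConst 4 4, IConst 5 40, IMul 6 0 4, IConst 7 33, IMul 8 1 3, IAdd 8 8 6,
       IAdd 8 8 5, IAdd 9 8 2, ISub 10 9 2, IConst 11 0] ;;
     Loop (LeI 7 6)
       (Blk [ILoad 12 7, IAdd 7 7 2, ILoad 13 7, IAdd 7 7 2, ILoad 14 7, IAdd 7 7 2, ILoad 15 7, IAdd 7 7 2] ;;
        emit_list)"

text \<open>The result also occupies the registers. The cells below 5 are restored last, the integer cell 1, which
  holds the constant 1 until then, last of all.\<close>

definition move_down :: com where
  "move_down = Blk [IConst 2 5, IMul 3 1 3, IAdd 0 8 2, IConst 1 1] ;;
     Loop (LeI 2 3) (Blk [ILoad 4 0, RLoad 0 0, IStore 2 4, RStore 2 0, IAdd 0 0 1, IAdd 2 2 1]) ;;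
     Blk [ISub 0 0 2, RLoad 0 0, IAdd 0 0 1, RLoad 1 0, IAdd 0 0 1, RLoad 2 0, ILoad 2 0, IAdd 0 0 1, RLoad 3 0,
       ILoad 3 0, IAdd 0 0 1, RLoad 4 0, ILoad 4 0, ISub 0 0 1, ISub 0 0 1, ISub 0 0 1, ILoad 1 0]"

definition report :: com where
  "report = emit ;; move_down"

text \<open>All targets lie below the source area, so nothing is overwritten before it is copied.
  One loop serves both memories, hence reals are copied up to \<open>2 * k\<close> too.\<close>

lemma wp_move_down:
  assumes i: "i 8 = int X" "i 1 = int k" "i 3 = 2" and X: "33 \<le> X" "2 * k < X"
    and Q: "\<And>\<tau>' i' re'. \<tau>' \<le> \<tau> + 16 * k + 40 \<Longrightarrow>
      (\<And>a. 1 \<le> a \<Longrightarrow> a \<le> 2 * k \<Longrightarrow> i' a = i (X + a)) \<Longrightarrow> (\<And>a. a \<le> 2 * k \<Longrightarrow> re' a = re (X + a)) \<Longrightarrow> Q \<tau>' i' re'"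
  shows "wp A B move_down Q \<tau> i re"
proof -
  define T where "T = \<tau> + 16 * k + 5"
  define Inv where "Inv \<tau>' i' re' \<longleftrightarrow> (\<exists>d. i' 0 = int X + int d \<and> i' (Suc 0) = 1 \<and> i' 2 = int d \<and> i' 3 = 2 * int k \<and> 5 \<le> d \<and>
      (d = 5 \<or> d \<le> 2 * k + 1) \<and> (\<forall>a. 5 \<le> a \<longrightarrow> a < d \<longrightarrow> i' a = i (X + a) \<and> re' a = re (X + a)) \<and>
      (\<forall>a. i' (X + a) = i (X + a) \<and> re' (X + a) = re (X + a)) \<and> \<tau>' \<le> \<tau> + 4 + 8 * (d - 5))"
    for \<tau>' :: nat and i' :: "nat \<Rightarrow> int" and re' :: "nat \<Rightarrow> real"
  have ne: "(X + x = c) = False" "(X = c) = False" if "c < 33" for x c :: nat using that X by auto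
  have ne1: "(Suc (X + x) = c) = False" "(Suc X = c) = False" if "c < 33" for x c :: nat using that X by auto
  show ?thesis
    unfolding move_down_def
  proof (rule wp_Seq, rule wp_Blk, simp, simp add: i[simplified], rule wp_Seq, rule wp_Loop[where Inv = Inv and T = T])
    show "Inv (Suc (Suc (Suc (Suc \<tau>)))) (i(2 := 5, 3 := int k * 2, 0 := int X + 5, Suc 0 := 1)) re"
      unfolding Inv_def by (intro exI[of _ 5]) (auto simp: ne)
  next
    fix \<tau>' i' re' assume "Inv \<tau>' i' re'" then show "\<tau>' \<le> T"
      unfolding Inv_def T_def by auto
  next
    fix \<tau>' i' re' assume "Inv \<tau>' i' re'" and h: "holds (LeI 2 3) i' re'"
    then obtain d where d: "i' 0 = int X + int d" "i' (Suc 0) = 1" "i' 2 = int d" "i' 3 = 2 * int k" "5 \<le> d"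
      "\<forall>a. 5 \<le> a \<longrightarrow> a < d \<longrightarrow> i' a = i (X + a) \<and> re' a = re (X + a)"
      "\<And>a. i' (X + a) = i (X + a)" "\<And>a. re' (X + a) = re (X + a)" "\<tau>' \<le> \<tau> + 4 + 8 * (d - 5)"
      unfolding Inv_def by auto
    have dk: "d \<le> 2 * k" using h d by simp
    have neq: "d \<noteq> 0" "d \<noteq> Suc 0" "d \<noteq> 2" "d \<noteq> 3" "d \<noteq> 4" "X + a \<noteq> d" for a using d(5) dk X by auto
    define i2 where "i2 = i'(4 := i (X + d), d := i (X + d), 0 := int X + int d + 1, 2 := int d + 1)"
    define re2 where "re2 = re'(0 := re (X + d), d := re (X + d))"
    have "Inv (Suc (Suc (Suc (Suc (Suc (Suc (Suc (Suc \<tau>')))))))) i2 re2"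
      unfolding Inv_def
    proof (intro exI[of _ "Suc d"] conjI allI impI)
      fix a assume a: "5 \<le> a" "a < Suc d"
      then show "i2 a = i (X + a)" "re2 a = re (X + a)"
        using d(6) unfolding i2_def re2_def by (auto simp: less_Suc_eq)
    qed (use d dk neq in \<open>auto simp: i2_def re2_def ne\<close>)
    then show "wp A B (Blk [ILoad 4 0, RLoad 0 0, IStore 2 4, RStore 2 0, IAdd 0 0 (Suc 0), IAdd 2 2 (Suc 0)])
        (\<lambda>\<tau>. Inv (\<tau> + 1)) (\<tau>' + 1) i' re'"
      by (intro wp_Blk) (simp, simp add: d nat_add_distrib ne neq neq(2)[symmetric] i2_def re2_def)
  next
    fix \<tau>' i' re' assume "Inv \<tau>' i' re'" and h: "\<not> holds (LeI 2 3) i' re'"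
    then obtain d where d: "i' 0 = int X + int d" "i' (Suc 0) = 1" "i' 2 = int d" "i' 3 = 2 * int k" "5 \<le> d" "d = 5 \<or> d \<le> 2 * k + 1"
      "\<forall>a. 5 \<le> a \<longrightarrow> a < d \<longrightarrow> i' a = i (X + a) \<and> re' a = re (X + a)"
      "\<And>a. i' (X + a) = i (X + a)" "\<And>a. re' (X + a) = re (X + a)" "\<tau>' \<le> \<tau> + 4 + 8 * (d - 5)"
      unfolding Inv_def by auto
    have X0: "i' X = i X" "re' X = re X" "i' (Suc X) = i (Suc X)" "re' (Suc X) = re (Suc X)"
      using d(8)[of 0] d(8)[of 1] d(9)[of 0] d(9)[of 1] by auto
    have X1: "i' (Suc (Suc X)) = i (X + 2)" "i' (3 + X) = i (X + 3)" "i' (4 + X) = i (X + 4)"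
      "re' (Suc (Suc X)) = re (X + 2)" "re' (3 + X) = re (X + 3)" "re' (4 + X) = re (X + 4)"
      using d(8)[of 2] d(8)[of 3] d(8)[of 4] d(9)[of 2] d(9)[of 3] d(9)[of 4] by (simp_all add: add.commute)
    have low: "a = 0 \<or> a = 1 \<or> a = 2 \<or> a = 3 \<or> a = 4 \<or> (5 \<le> a \<and> a < d)" if "a \<le> 2 * k" for a
      using that h d by simp linarith
    \<comment> \<open>Source address minus loop counter is \<open>X\<close>, whatever the counter
      was on exit; this also covers \<open>2 * k < 5\<close>, when the loop never ran.\<close>
    show "wp A B (Blk [ISub 0 0 2, RLoad 0 0, IAdd 0 0 (Suc 0), RLoad (Suc 0) 0, IAdd 0 0 (Suc 0), RLoad 2 0, ILoad 2 0, IAdd 0 0 (Suc 0), RLoad 3 0,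
       ILoad 3 0, IAdd 0 0 (Suc 0), RLoad 4 0, ILoad 4 0, ISub 0 0 (Suc 0), ISub 0 0 (Suc 0), ISub 0 0 (Suc 0), ILoad (Suc 0) 0])
       Q (\<tau>' + 2) i' re'"
      apply (rule wp_Blk, simp)
      apply (simp add: d(1-3,8,9) nat_add_distrib ne ne1 X0)
      apply (rule Q)
      subgoal using d(6,10) by auto
      subgoal for a using low[of a] d(7) by (auto simp: X0 X1)
      subgoal for a using low[of a] d(7) by (auto simp: X0 X1)
      done
  qed
qed

text \<open>The format of \<open>lists_explicitly\<close> shifted by \<open>X\<close>, for output
  written so far.\<close>

definition out :: "(nat \<Rightarrow> real) \<Rightarrow> (nat \<Rightarrow> real) \<Rightarrow> nat \<Rightarrow> (int \<times> int) list \<Rightarrow> (nat \<Rightarrow> int) \<Rightarrow> (nat \<Rightarrow> real) \<Rightarrow> bool" where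
  "out A B X xs i re \<longleftrightarrow> i 9 = int X + 1 + 2 * int (length xs) \<and> i 10 = int X + int (length xs) \<and>
     (\<forall>t<length xs. i (X + (2 * t + 1)) = fst (xs ! t) \<and> i (X + (2 * t + 2)) = snd (xs ! t) \<and>
        re (X + t) = Mval A B (xs ! t))"

lemma out_snoc:
  assumes "out A B X xs i re" "L = length xs"
    and "i' 9 = int X + 3 + 2 * int L" "i' 10 = int X + int L + 1"
    and "i' (X + (2 * L + 1)) = fst q" "i' (X + (2 * L + 2)) = snd q" "re' (X + L) = Mval A B q"
    and "\<And>a. 1 \<le> a \<Longrightarrow> a < 2 * L + 1 \<Longrightarrow> i' (X + a) = i (X + a)" "\<And>a. a < L \<Longrightarrow> re' (X + a) = re (X + a)"
  shows "out A B X (xs @ [q]) i' re'"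
proof -
  have "i' (X + (2 * t + 1)) = fst ((xs @ [q]) ! t) \<and> i' (X + (2 * t + 2)) = snd ((xs @ [q]) ! t) \<and>
        re' (X + t) = Mval A B ((xs @ [q]) ! t)" if "t < Suc (length xs)" for t
  proof (cases "t = L")
    case True
    then show ?thesis using assms by (simp add: nth_append)
  next
    case False
    then have t: "t < L" using that assms(2) by simp
    then show ?thesis
      using assms(1) assms(8)[of "2 * t + 1"] assms(8)[of "2 * t + 2"] assms(9)[of t]
      unfolding out_def assms(2) by (auto simp: nth_append)
  qed
  then show ?thesis unfolding out_def using assms(2-4) by auto
qed

context selection
begin

definition listing :: "(nat \<Rightarrow> int) \<Rightarrow> nat \<Rightarrow> (int \<times> int) list" where
  "listing hi w = map (list_pos r w) [list_lo r w..hi w]"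

definition listings :: "(nat \<Rightarrow> int) \<Rightarrow> nat \<Rightarrow> (int \<times> int) list" where
  "listings hi w = concat (map (listing hi) [0..<w])"

lemma listings_Suc: "listings hi (Suc w) = listings hi w @ listing hi w"
  unfolding listings_def by simp

lemma length_listings:
  assumes g: "good hi" and w: "w \<le> 2 * r"
  shows "int (length (listings hi w)) = (\<Sum>w'<w. hi w' - list_lo r w' + 1)"
  using w
proof (induction w)
  case (Suc w)
  then have "list_lo r w - 1 \<le> hi w" using g unfolding good_def by auto
  then show ?case using Suc by (simp add: listings_Suc listing_def)
qed (simp add: listings_def)

lemma listings_mono: "w \<le> w' \<Longrightarrow> length (listings hi w) \<le> length (listings hi w')"
  by (induction w' rule: dec_induct) (auto simp: listings_Suc)

text \<open>Distinctness comes from counting: a list of length \<open>k\<close> whose set has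
  \<open>k\<close> elements repeats nothing.\<close>

lemma listings_all:
  assumes g: "good hi" "taken hi = int k"
  shows "length (listings hi (2 * r)) = k" "set (listings hi (2 * r)) = selected hi" "distinct (listings hi (2 * r))"
proof -
  show len: "length (listings hi (2 * r)) = k"
    using length_listings[OF g(1), of "2 * r"] g(2) unfolding taken_def by simp
  show set: "set (listings hi (2 * r)) = selected hi"
    unfolding listings_def listing_def selected_def accepted_def by force
  show "distinct (listings hi (2 * r))"
    by (rule card_distinct) (simp add: len set card_selected[OF g])
qed

lemma wp_emit_list:
  assumes o: "out A B X pre i re" and X: "33 \<le> X"
    and i: "i 2 = 1" "i 11 = 0" "i 14 = list_lo r w" "i 15 = hi w"
      "i 12 = (if w < r then 0 else 1)" "i 13 = (if w < r then int w + 1 else int w - int r + 1)"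
    and lo: "list_lo r w - 1 \<le> hi w"
    and Q: "\<And>\<tau>' i' re'. \<tau>' \<le> \<tau> + 20 * length (listing hi w) + 5 \<Longrightarrow> out A B X (pre @ listing hi w) i' re' \<Longrightarrow>
      (\<And>a. a \<le> X \<Longrightarrow> a < 9 \<or> a = 11 \<or> 17 < a \<Longrightarrow> i' a = i a) \<Longrightarrow> Q \<tau>' i' re'"
  shows "wp A B emit_list Q \<tau> i re"
proof -
  define T where "T = \<tau> + 20 * length (listing hi w)"
  define Inv where "Inv \<tau>' i' re' \<longleftrightarrow> (\<exists>p. list_lo r w \<le> p \<and> p \<le> hi w + 1 \<and> i' 14 = p \<and>
      out A B X (pre @ map (list_pos r w) [list_lo r w..p - 1]) i' re' \<and>
      (\<forall>a\<le>X. a \<notin> {9, 10, 14, 16, 17} \<longrightarrow> i' a = i a) \<and> \<tau>' + 20 * nat (hi w + 1 - p) \<le> T)"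
    for \<tau>' :: nat and i' :: "nat \<Rightarrow> int" and re' :: "nat \<Rightarrow> real"
  have ne: "(X + x = c) = False" "(X = c) = False" if "c < 33" for x c :: nat using that X by auto
  have ne1: "(Suc (X + x) = c) = False" "(Suc X = c) = False" if "c < 33" for x c :: nat using that X by auto
  show ?thesis
    unfolding emit_list_def
  proof (rule wp_Loop[where Inv = Inv and T = T])
    show "Inv \<tau> i re"
      unfolding Inv_def using o i lo by (intro exI[of _ "list_lo r w"]) (auto simp: T_def listing_def)
  next
    show "Inv \<tau>' i' re' \<Longrightarrow> \<tau>' \<le> T" for \<tau>' i' re'
      unfolding Inv_def by auto
  next
    fix \<tau>' i' re' assume "Inv \<tau>' i' re'" and h: "\<not> holds (LeI 14 15) i' re'"
    then obtain p where p: "p \<le> hi w + 1" "i' 14 = p" "\<forall>a\<le>X. a \<notin> {9, 10, 14, 16, 17} \<longrightarrow> i' a = i a" "\<tau>' \<le> T"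
      "out A B X (pre @ map (list_pos r w) [list_lo r w..p - 1]) i' re'"
      unfolding Inv_def by auto
    have "p = hi w + 1" using h p i X by simp
    with p show "Q (\<tau>' + 2) i' re'" by (intro Q) (auto simp: listing_def T_def)
  next
    fix \<tau>' i' re' assume "Inv \<tau>' i' re'" and h: "holds (LeI 14 15) i' re'"
    then obtain p where p: "list_lo r w \<le> p" "i' 14 = p" "\<tau>' + 20 * nat (hi w + 1 - p) \<le> T"
      and fr: "\<And>a. a \<le> X \<Longrightarrow> a \<notin> {9, 10, 14, 16, 17} \<Longrightarrow> i' a = i a"
      and o': "out A B X (pre @ map (list_pos r w) [list_lo r w..p - 1]) i' re'"
      unfolding Inv_def by auto
    define xs where "xs = pre @ map (list_pos r w) [list_lo r w..p - 1]"
    define L where "L = length xs"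
    have c: "i' 2 = 1" "i' 11 = 0" "i' 15 = hi w" "i' 12 = (if w < r then 0 else 1)"
      "i' 13 = (if w < r then int w + 1 else int w - int r + 1)"
      using fr i X by auto
    \<comment> \<open>Opaque names for the two target addresses keep them intact under
      simplification.\<close>
    define Y where "Y = X + (2 * L + 1)"
    define Z where "Z = X + L"
    have o9: "i' 9 = int Y" "i' 10 = int Z"
      using o' unfolding out_def Y_def Z_def xs_def L_def by auto
    have neY: "(Y = c) = False" "(Suc Y = c) = False" "(Z = c) = False" if "c < 33" for c :: nat
      using that X unfolding Y_def Z_def by auto
    have ph: "p \<le> hi w" using h c p by simp
    have time: "\<tau>' + 20 + 20 * nat (hi w + 1 - (p + 1)) \<le> T"
      using p(3) ph by (simp add: nat_diff_distrib' algebra_simps)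
    have step: "Inv t i2 re2"
      if "t \<le> \<tau>' + 18"
        "i2 = i'(16 := fst q, 17 := snd q, Y := fst q, Suc Y := snd q,
             9 := int Y + 2, 10 := int Z + 1, 14 := p + 1)"
        "re2 = re'(3 := y, 2 := Mval A B q, Z := Mval A B q)" "q = list_pos r w p" for t i2 re2 q y
    proof -
      have "out A B X (xs @ [q]) i2 re2"
        by (rule out_snoc[OF o'[folded xs_def] L_def]) (auto simp: that(2,3) ne ne1 Y_def Z_def)
      moreover have "xs @ [q] = pre @ map (list_pos r w) [list_lo r w..(p + 1) - 1]"
        unfolding xs_def that(4) using upto_rec2[OF p(1)] by simp
      ultimately show ?thesis
        unfolding Inv_def using p ph time that(1) fr
        by (intro exI[of _ "p + 1"]) (auto simp: that(2) ne ne1 Y_def Z_def)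
    qed
    have neY1: "Suc 0 \<noteq> Y" using X unfolding Y_def by auto
    define q where "q = list_pos r w p"
    let ?W = "Blk [RReadA 2 16, RReadB 3 17, RAdd 2 2 3, RStore 10 2, IStore 9 16, IAdd 9 9 2, IStore 9 17, IAdd 9 9 2,
        IAdd 10 10 2, IAdd 14 14 2]"
    have tail: "wp A B ?W (\<lambda>\<tau>. Inv (\<tau> + 1)) t (i'(16 := fst q, 17 := snd q)) re'" if t: "t \<le> \<tau>' + 7" for t
      apply (rule wp_Blk, simp)
      apply (simp add: c o9 p(2) neY neY1 nat_add_distrib)
      apply (rule step[OF _ _ _ q_def])
        apply (use t in simp)
       apply (simp add: add.commute)
      apply (simp add: Mval_def)
      done
    show "wp A B (Choose (LeI 12 11) (Blk [IAdd 16 13 11, IAdd 17 14 11]) (Blk [IAdd 16 14 11, IAdd 17 13 11]) ;;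
      Blk [RReadA 2 16, RReadB 3 17, RAdd 2 2 3, RStore 10 2, IStore 9 16, IAdd 9 9 2, IStore 9 17, IAdd 9 9 2,
        IAdd 10 10 2, IAdd 14 14 2]) (\<lambda>\<tau>. Inv (\<tau> + 1)) (\<tau>' + 1) i' re'"
    proof (rule wp_Seq, rule wp_Choose)
      assume "holds (LeI 12 11) i' re'"
      then have "w < r" using c by (simp split: if_splits)
      then show "wp A B (Blk [IAdd 16 13 11, IAdd 17 14 11]) (wp A B ?W (\<lambda>\<tau>. Inv (\<tau> + 1))) (\<tau>' + 1 + 1) i' re'"
        using tail c p(2) by (intro wp_Blk) (simp_all add: q_def list_pos_def)
    next
      assume "\<not> holds (LeI 12 11) i' re'"
      then have "\<not> w < r" using c by (simp split: if_splits)
      then show "wp A B (Blk [IAdd 16 14 11, IAdd 17 13 11]) (\<lambda>\<tau>. wp A B ?W (\<lambda>\<tau>. Inv (\<tau> + 1)) (\<tau> + 1)) (\<tau>' + 1 + 1) i' re'"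
        using tail c p(2) by (intro wp_Blk) (simp_all add: q_def list_pos_def)
    qed
  qed
qed

lemma wp_emit:
  assumes fs: "final_state hi i" and X: "X = 8 * r + 2 * k + 72"
    and Q: "\<And>\<tau>' i' re'. \<tau>' \<le> \<tau> + 20 * k + 40 * r + 14 \<Longrightarrow> out A B X (listings hi (2 * r)) i' re' \<Longrightarrow>
      i' 8 = int X \<Longrightarrow> i' 1 = int k \<Longrightarrow> i' 3 = 2 \<Longrightarrow> Q \<tau>' i' re'"
  shows "wp A B emit Q \<tau> i re"
proof -
  have i: "i 0 = 2 * int r + 8" "i (Suc 0) = int k" and g: "good hi" "taken hi = int k"
    and desc: "\<And>w. w < 2 * r \<Longrightarrow> desc_ok hi i w"
    using fs unfolding final_state_def by auto
  have ne: "(X + x = c) = False" "(X = c) = False" if "c < 33" for x c :: nat using that X by auto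
  have ne1: "(Suc (X + x) = c) = False" "(Suc X = c) = False" if "c < 33" for x c :: nat using that X by auto
  define T where "T = \<tau> + 20 * k + 40 * r + 12"
  define Inv where "Inv \<tau>' i' re' \<longleftrightarrow> (\<exists>w\<le>2 * r. i' 7 = 33 + int w * 4 \<and> i' 6 = 8 * int r + 32 \<and> i' 2 = 1 \<and> i' 11 = 0 \<and>
      i' 8 = int X \<and> i' 3 = 2 \<and> i' (Suc 0) = int k \<and> (\<forall>a. 33 \<le> a \<longrightarrow> a < base \<longrightarrow> i' a = i a) \<and>
      out A B X (listings hi w) i' re' \<and> \<tau>' \<le> \<tau> + 20 * length (listings hi w) + 20 * w + 12)"
    for \<tau>' :: nat and i' :: "nat \<Rightarrow> int" and re' :: "nat \<Rightarrow> real"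
  show ?thesis
    unfolding emit_def
  proof (rule wp_Seq, rule wp_Blk, simp, simp add: i, rule wp_Loop[where Inv = Inv and T = T])
    show "Inv (Suc (Suc (Suc (Suc (Suc (Suc (Suc (Suc (Suc (Suc (Suc (Suc \<tau>))))))))))))
      (i(2 := 1, 3 := 2, 4 := 4, 5 := 40, 6 := 8 * int r + 32, 7 := 33, 8 := 72 + (int k * 2 + 8 * int r),
           9 := 73 + (int k * 2 + 8 * int r), 10 := 72 + (int k * 2 + 8 * int r), 11 := 0)) re"
      unfolding Inv_def using i by (intro exI[of _ 0]) (auto simp: out_def listings_def X)
  next
    fix \<tau>' i' re' assume "Inv \<tau>' i' re'"
    then show "\<tau>' \<le> T"
      using listings_mono[of _ "2 * r" hi] listings_all(1)[OF g] unfolding Inv_def T_def by fastforce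
  next
    fix \<tau>' i' re' assume "Inv \<tau>' i' re'" and h: "\<not> holds (LeI 7 6) i' re'"
    then obtain w where w: "w \<le> 2 * r" "i' 7 = 33 + int w * 4" "i' 6 = 8 * int r + 32" "i' 8 = int X" "i' 3 = 2"
      "i' (Suc 0) = int k" "out A B X (listings hi w) i' re'" "\<tau>' \<le> \<tau> + 20 * length (listings hi w) + 20 * w + 12"
      unfolding Inv_def by auto
    have "w = 2 * r" using h w by simp
    with w listings_all(1)[OF g] show "Q (\<tau>' + 2) i' re'" by (intro Q) auto
  next
    fix \<tau>' i' re' assume "Inv \<tau>' i' re'" and h: "holds (LeI 7 6) i' re'"
    then obtain w where w: "w \<le> 2 * r" "i' 7 = 33 + int w * 4" "i' 6 = 8 * int r + 32"
      and c: "i' 2 = 1" "i' 11 = 0" "i' 8 = int X" "i' 3 = 2" "i' (Suc 0) = int k"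
      and fr: "\<And>a. 33 \<le> a \<Longrightarrow> a < base \<Longrightarrow> i' a = i a"
      and o: "out A B X (listings hi w) i' re'" and time: "\<tau>' \<le> \<tau> + 20 * length (listings hi w) + 20 * w + 12"
      unfolding Inv_def by auto
    have w2: "w < 2 * r" using h w by simp
    have d: "desc_ok hi i' w" by (rule desc_ok_cong[OF desc[OF w2] w2 fr])
    define kd where "kd = i' (33 + 4 * w)"
    define b where "b = i' (34 + 4 * w)"
    have d': "i' (33 + 4 * w) = kd" "i' (34 + 4 * w) = b" "i' (35 + 4 * w) = list_lo r w" "i' (36 + 4 * w) = hi w"
      and kd: "kd = (if w < r then 0 else 1)" "b = (if w < r then int w + 1 else int w - int r + 1)"
      using d unfolding desc_ok_def kd_def b_def by auto
    have ad: "nat (33 + int w * 4) = 33 + 4 * w" "nat (34 + int w * 4) = 34 + 4 * w"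
       "nat (35 + int w * 4) = 35 + 4 * w" "nat (36 + int w * 4) = 36 + 4 * w" by auto
    define i2 where "i2 = i'(12 := kd, 13 := b, 14 := list_lo r w, 15 := hi w, 7 := 37 + int w * 4)"
    have lo: "list_lo r w - 1 \<le> hi w" using g(1) w2 unfolding good_def by auto
    have o2: "out A B X (listings hi w) i2 re'"
      using o unfolding out_def i2_def by (auto simp: ne ne1)
    have main: "wp A B emit_list (\<lambda>\<tau>. Inv (Suc \<tau>)) (Suc (Suc (Suc (Suc (Suc (Suc (Suc (Suc (Suc \<tau>'))))))))) i2 re'"
    proof (rule wp_emit_list[where w = w and hi = hi, OF o2 _ _ _ _ _ _ _ lo])
      show "33 \<le> X" using X by simp
      show "i2 2 = 1" "i2 11 = 0" "i2 14 = list_lo r w" "i2 15 = hi w" "i2 12 = (if w < r then 0 else 1)"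
        "i2 13 = (if w < r then int w + 1 else int w - int r + 1)"
        unfolding i2_def using c kd by auto
      fix t i3 re3 assume a: "t \<le> Suc (Suc (Suc (Suc (Suc (Suc (Suc (Suc (Suc \<tau>')))))))) + 20 * length (listing hi w) + 5"
        "out A B X (listings hi w @ listing hi w) i3 re3" "\<And>a. a \<le> X \<Longrightarrow> a < 9 \<or> a = 11 \<or> 17 < a \<Longrightarrow> i3 a = i2 a"
      have fr2: "i3 a = i a" if "33 \<le> a" "a < base" for a
        using a(3)[of a] that fr[of a] X unfolding i2_def base_def by auto
      show "Inv (Suc t) i3 re3"
        unfolding Inv_def
        using w2 w c a time fr2 X by (intro exI[of _ "Suc w"]) (auto simp: listings_Suc i2_def)
    qed
    show "wp A B (Blk [ILoad 12 7, IAdd 7 7 2, ILoad 13 7, IAdd 7 7 2, ILoad 14 7, IAdd 7 7 2, ILoad 15 7, IAdd 7 7 2] ;;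
        emit_list) (\<lambda>\<tau>. Inv (\<tau> + 1)) (\<tau>' + 1) i' re'"
      using main by (intro wp_Seq wp_Blk) (simp, simp add: w c d' ad i2_def)
  qed
qed

lemma wp_report:
  assumes fs: "final_state hi i"
    and Q: "\<And>\<tau>' i' re'. \<tau>' \<le> \<tau> + 36 * k + 40 * r + 60 \<Longrightarrow>
      (\<And>s. im s = i' \<Longrightarrow> rm s = re' \<Longrightarrow> lists_explicitly A B k (selected hi) s) \<Longrightarrow> Q \<tau>' i' re'"
  shows "wp A B report Q \<tau> i re"
  unfolding report_def
proof (rule wp_Seq, rule wp_emit[OF fs refl])
  have g: "good hi" "taken hi = int k" using fs unfolding final_state_def by auto
  let ?X = "8 * r + 2 * k + 72" and ?xs = "listings hi (2 * r)"
  note xs = listings_all[OF g]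
  fix t i1 re1
  assume a: "t \<le> \<tau> + 20 * k + 40 * r + 14" "out A B ?X ?xs i1 re1"
    "i1 8 = int ?X" "i1 1 = int k" "i1 3 = 2"
  show "wp A B move_down Q t i1 re1"
  proof (rule wp_move_down[OF a(3-5)])
    fix t' i' re'
    assume b: "t' \<le> t + 16 * k + 40" "\<And>a. 1 \<le> a \<Longrightarrow> a \<le> 2 * k \<Longrightarrow> i' a = i1 (?X + a)"
      "\<And>a. a \<le> 2 * k \<Longrightarrow> re' a = re1 (?X + a)"
    have v: "(i' (2 * t + 1), i' (2 * t + 2)) = ?xs ! t \<and> re' t = Mval A B (?xs ! t)" if "t < k" for t
      using a(2) b(2)[of "2 * t + 1"] b(2)[of "2 * t + 2"] b(3)[of t] that unfolding out_def xs(1) by simp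
    have "lists_explicitly A B k (selected hi) s" if "im s = i'" "rm s = re'" for s
      unfolding lists_explicitly_def that
    proof (intro conjI allI impI)
      show "inj_on (\<lambda>t. (i' (2 * t + 1), i' (2 * t + 2))) {..<k}"
        by (rule inj_onI) (metis v xs(1,3) lessThan_iff nth_eq_iff_index_eq)
      have "(\<lambda>t. (i' (2 * t + 1), i' (2 * t + 2))) ` {..<k} = (\<lambda>t. ?xs ! t) ` {..<k}"
        using v by (intro image_cong) auto
      also have "\<dots> = set ?xs" unfolding set_conv_nth xs(1) by auto
      finally show "(\<lambda>t. (i' (2 * t + 1), i' (2 * t + 2))) ` {..<k} = selected hi" using xs(2) by simp
      show "re' t = Mval A B (i' (2 * t + 1), i' (2 * t + 2))" if "t < k" for t
        using v[OF that] by simp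
    qed
    then show "Q t' i' re'" using a(1) b(1) by (intro Q) auto
  qed auto
qed

end

section \<open>Time bounds\<close>

text \<open>For the least such \<open>l\<close>, \<open>2 ^ (l - 1) < 4 * k\<close> gives
  \<open>l \<le> 3 + log 2 k\<close>. Since \<open>log 2 (k + 1) \<ge> 1\<close> for
  \<open>k \<ge> 1\<close>, the constant is absorbed.\<close>

lemma exists_log_bound:
  assumes k: "1 \<le> k"
  obtains l where "4 * k \<le> 2 ^ l" "real l \<le> 4 * log 2 (real k + 1)"
proof -
  define l where "l = (LEAST l. 4 * k \<le> 2 ^ l)"
  have "4 * k \<le> 2 ^ (4 * k)" by (rule less_imp_le[OF less_exp])
  then have le: "4 * k \<le> 2 ^ l"
    unfolding l_def by (rule LeastI)
  have "l \<noteq> 0"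
  proof
    assume "l = 0"
    then show False using le k by simp
  qed
  then obtain l' where l': "l = Suc l'" using not0_implies_Suc by blast
  have "\<not> 4 * k \<le> 2 ^ l'"
    by (rule not_less_Least) (use l' in \<open>simp add: l_def\<close>)
  then have "2 ^ l' \<le> 4 * k" by simp
  then have "real (2 ^ l') \<le> real (4 * k)" by (rule of_nat_mono)
  then have "2 ^ l' \<le> 4 * real k" by simp
  then have "log 2 (2 ^ l') \<le> log 2 (4 * real k)" by (rule log_mono[rotated 2]) simp_all
  also have "\<dots> = log 2 4 + log 2 (real k)" using k by (simp add: log_mult)
  also have "log 2 4 = (2 :: real)" using log2_of_power_eq[of 4 2] by simp
  finally have "real l' \<le> 2 + log 2 (real k)" by simp
  also have "log 2 (real k) \<le> log 2 (real k + 1)" using k by simp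
  finally have "real l \<le> 3 + log 2 (real k + 1)" unfolding l' by simp
  moreover have "log 2 2 \<le> log 2 (real k + 1)" by (rule log_mono) (use k in auto)
  then have "1 \<le> log 2 (real k + 1)" by simp
  ultimately have "real l \<le> 4 * log 2 (real k + 1)" by linarith
  then show ?thesis using that le by blast
qed

text \<open>The true order is \<open>x * y ^ 2\<close>, one logarithm for the phases and one for the
  tree. The coefficients add up to 7716, below 10000.\<close>

lemma select_time_bound:
  fixes r l t :: nat and x y :: real
  assumes t: "t \<le> 25 * r + 50 + l * (2 * r * (25 * l + 50 + 3) + 4 * r * (25 * l + 50 + 9) + 20)"
    and r: "real r \<le> 2 * x" and l: "real l \<le> 4 * y" and x: "1 \<le> x" and y: "1 \<le> y"
  shows "real t \<le> 10000 * x * y ^ 3"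
proof -
  have xy: "x \<le> x * y" "y \<le> x * y" "1 \<le> x * y" using x y by (simp_all add: mult_ge1_I)
  have "real t \<le> 25 * real r + 50 + real l * (real r * (150 * real l + 342) + 20)"
    using of_nat_mono[OF t, where 'a = real] by (simp add: algebra_simps)
  also have "\<dots> \<le> 25 * (2 * x) + 50 + (4 * y) * ((2 * x) * (150 * (4 * y) + 342) + 20)"
    by (intro add_mono mult_mono) (use r l x y in auto)
  also have "\<dots> = 50 * x + 50 + 4800 * (x * y ^ 2) + 2736 * (x * y) + 80 * y"
    by (simp add: algebra_simps power2_eq_square)
  also have "\<dots> \<le> 10000 * (x * y ^ 3)"
  proof -
    have p: "y \<le> y ^ 3" "y ^ 2 \<le> y ^ 3" "1 \<le> y ^ 3"
      using power_increasing[of 1 3 y] power_increasing[of 2 3 y] power_increasing[of 0 3 y] y by auto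
    have "x * y \<le> x * y ^ 3" "x * y ^ 2 \<le> x * y ^ 3" using p x by (auto intro!: mult_left_mono)
    then show ?thesis using xy by linarith
  qed
  finally show ?thesis by (simp add: mult.assoc)
qed

theorem theorem1:
  shows "\<exists>(P :: instr list) (Q :: instr list) (c :: real). c > 0 \<and>
    (\<forall>(n :: nat) (k :: nat) (A :: nat \<Rightarrow> real) (B :: nat \<Rightarrow> real).
       sorted_noninc A n \<longrightarrow> sorted_noninc B n \<longrightarrow> 1 \<le> k \<longrightarrow> k \<le> n ^ 2 \<longrightarrow>
       (\<exists>t1 s1. runs P A B (init n k) t1 s1 \<and>
          real t1 \<le> c * sqrt (real k) * (log 2 (real k + 1)) ^ 3 \<and>
          real (num_desc s1) \<le> c * sqrt (real k) \<and>
          is_staircase (decode s1) \<and> top_k A B n k (decode s1) \<and>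
          (\<exists>t2 s2. runs Q A B (s1\<lparr>pc := 0\<rparr>) t2 s2 \<and> real t2 \<le> c * real k \<and>
             lists_explicitly A B k (decode s1) s2)))"
\<comment> \<open>The constant is dictated by the selection time; the number of descriptors and the
  reporting time need far less.\<close>
proof (rule exI[of _ "compile 0 select"], rule exI[of _ "compile 0 report"], rule exI[of _ 10000], intro conjI allI impI)
  fix n k :: nat and A B :: "nat \<Rightarrow> real"
  assume A: "sorted_noninc A n" and B: "sorted_noninc B n" and k: "1 \<le> k" "k \<le> n ^ 2"
  let ?x = "sqrt (real k)" and ?y = "log 2 (real k + 1)"
  obtain l where lk: "4 * k \<le> 2 ^ l" "real l \<le> 4 * ?y" using exists_log_bound[OF k(1)] .
  let ?Q = "\<lambda>t i re. \<exists>r hi. selection A B n k r l \<and> (r - 1) * (r - 1) < k \<and>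
      t \<le> 25 * r + 50 + l * selection.phase_time r l \<and> selection.final_state A B n k r hi i"
  have "wp A B select ?Q 0 (im (init n k)) (rm (init n k))"
    by (rule wp_select[OF A B k lk(1)]) blast
  moreover have pc0: "pc (init n k) = 0" by (simp add: init_def)
  ultimately obtain t1 s1 r hi where run: "runs (compile 0 select) A B (init n k) t1 s1"
    and sel: "selection A B n k r l" and rk: "(r - 1) * (r - 1) < k"
    and t1: "t1 \<le> 25 * r + 50 + l * selection.phase_time r l"
    and fs: "selection.final_state A B n k r hi (im s1)"
    using wp_runs by blast
  interpret selection A B n k r l by (rule sel)
  have g: "good hi" "taken hi = int k" using fs unfolding final_state_def by auto
  note dec = decode_final_state[OF fs]
  have x: "1 \<le> ?x" using k by simp
  have y: "1 \<le> ?y"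
  proof -
    have "log 2 2 \<le> ?y" by (rule log_mono) (use k in auto)
    then show ?thesis by simp
  qed
  have "real ((r - 1) * (r - 1)) \<le> real k" using rk by (intro of_nat_mono) simp
  then have "real (r - 1) ^ 2 \<le> real k" by (simp add: power2_eq_square)
  then have "real (r - 1) \<le> ?x" by (rule real_le_rsqrt)
  moreover have "real (r - 1) = real r - 1" using r_pos by simp
  \<comment> \<open>From \<open>r - 1 \<le> sqrt k\<close> and
    \<open>1 \<le> sqrt k\<close>.\<close>
  ultimately have rx: "real r \<le> 2 * ?x" using x by linarith
  have xk: "?x \<le> real k"
    by (rule real_le_lsqrt) (use k in \<open>auto simp: power2_eq_square\<close>)
  have num: "real (num_desc s1) \<le> 10000 * ?x"
  proof -
    have "num_desc s1 = 2 * r + 8" using fs unfolding num_desc_def final_state_def by auto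
    then have "real (num_desc s1) = 2 * real r + 8" by simp
    then show ?thesis using rx x by linarith
  qed
  have time: "real t1 \<le> 10000 * ?x * ?y ^ 3"
    by (rule select_time_bound[OF t1[unfolded phase_time_def U_def] rx lk(2) x y])
  let ?R = "\<lambda>t i re. t \<le> 36 * k + 40 * r + 60 \<and>
     (\<forall>s. im s = i \<longrightarrow> rm s = re \<longrightarrow> lists_explicitly A B k (selected hi) s)"
  have "wp A B report ?R 0 (im (s1\<lparr>pc := 0\<rparr>)) (rm (s1\<lparr>pc := 0\<rparr>))"
    by (rule wp_report[of hi]) (use fs in auto)
  from wp_runs[OF this] obtain t2 s2 where run2: "runs (compile 0 report) A B (s1\<lparr>pc := 0\<rparr>) t2 s2"
    and t2: "t2 \<le> 36 * k + 40 * r + 60" and le: "lists_explicitly A B k (selected hi) s2"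
    by auto
  have "real t2 \<le> 36 * real k + 40 * real r + 60" using of_nat_mono[OF t2, where 'a = real] by simp
  also have "\<dots> \<le> 10000 * real k" using rx xk k(1) by linarith
  finally have t2k: "real t2 \<le> 10000 * real k" .
  show "\<exists>t1 s1. runs (compile 0 select) A B (init n k) t1 s1 \<and>
          real t1 \<le> 10000 * sqrt (real k) * (log 2 (real k + 1)) ^ 3 \<and>
          real (num_desc s1) \<le> 10000 * sqrt (real k) \<and>
          is_staircase (decode s1) \<and> top_k A B n k (decode s1) \<and>
          (\<exists>t2 s2. runs (compile 0 report) A B (s1\<lparr>pc := 0\<rparr>) t2 s2 \<and> real t2 \<le> 10000 * real k \<and>
             lists_explicitly A B k (decode s1) s2)"
    by (rule exI[of _ t1], rule exI[of _ s1])
      (use run run2 t2k le time num staircase_selected[OF g] top_k_selected[OF g] dec in auto)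
qed simp

end
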